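(* Assume: (A1) for any given $d\in\mathbb{R}^r$, $h(u,d)$ is differentiable in $u$; (A4) $\mathcal{U}\subset\mathbb{R}^p$ is compact and convex with diameter $D>0$, i.e. $\|u_1-u_2\|\le D$ for all $u_1,u_2\in\mathcal{U}$; (A5) for each $k$, $\tilde\Phi_k(u)$ is convex, $L_k$-smooth and $M_k$-Lipschitz in $u$, and $\Phi_k(u,y)$ is $M_{\Phi,k}$-Lipschitz in $y$; the sequences $\{L_k\},\{M_k\},\{M_{\Phi,k}\}$ are bounded; (A6) there exist $G\ge0$ and $\tau>0$ such that $|\tilde\Phi_k(u)|\le G$ for all $u\in\mathcal{U}_\tau$ and all $k\in\mathbb{N}$, where $\mathcal{U}_\tau=\{u+\tau v:u\in\mathcal{U},\ \|v\|\le1\}$. Let $T\in\mathbb{N}_+$, $\mathrm{Reg}_T^d=\sum_{k=1}^T\big(\mathbb{E}[\tilde\Phi_k(w_k)]-\tilde\Phi_k(u_k^* )\big)$ and $C_T=\sum_{k=1}^T\|u_k^*-u_{k-1}^*\|$. (i) The closed-loop interconnection of the plant $y_k=h(u_k,d_k)$ and the model-based controller (defined in the context) with $\eta=1/\sqrt T$ ensures $$\mathrm{Reg}_T^d=\begin{cases}\mathcal{O}\big(\sqrt T\,C_T+T^{\max(\frac12,1-\theta)}\big)&\text{if }\epsilon_{H,k}\le\bar\epsilon'/(k+1)^\theta\ \forall k\in\mathbb{N},\ \theta\ge\frac13,\ \bar\epsilon'>0,\\ \mathcal{O}\big(\sqrt T(C_T+1)+T\big)&\text{if }\epsilon_{H,k}\le\bar\epsilon\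 \forall k\in\mathbb{N},\ \bar\epsilon>0,\\ \mathcal{O}\big(\sqrt T(C_T+1)+T^{1-\theta}\big)&\text{if }\epsilon_{H,k}\le\bar\epsilon'/(k+1)^\theta\ \forall k\in\mathbb{N},\ \theta\in(0,\frac13),\ \bar\epsilon'>0.\end{cases}$$ (ii) The closed-loop interconnection of the plant $y_k=h(u_k,d_k)$ and the model-free controller (defined in the context) with $\eta=1/(p^{2/3}T^{2/3})$ and $\delta=\min(p^{1/3}/T^{1/6},\tau)$ incurs $$\mathrm{Reg}_T^d=\mathcal{O}\big(p^{2/3}T^{2/3}(C_T+1)\big).$$
   Context: Problem. $p,q,r$ are positive integers. At each time $k\in\mathbb{N}=\{0,1,\dots\}$ one has a differentiable objective $\Phi_k:\mathbb{R}^p\times\mathbb{R}^q\to\mathbb{R}$ and a disturbance $d_k\in\mathbb{R}^r$; $h:\mathbb{R}^p\times\mathbb{R}^r\to\mathbb{R}^q$ is the steady-state input-output map and $\mathcal{U}\subset\mathbb{R}^p$ the input constraint set. The reduced objective is $\tilde\Phi_k(u)=\Phi_k(u,h(u,d_k))$; "$L_k$-smooth" means its gradient is $L_k$-Lipschitz. $u_k^*$ denotes a minimizer of $\tilde\Phi_k$ over $\mathcal{U}$. $\nabla_uh(u,d)\in\mathbb{R}^{p\times q}$ is the transposed Jacobian of $h$ in $u$. $\mathrm{Proj}_{\mathcal{U}}$ is Euclidean projection onto $\mathcal{U}$. In both controllers $w_0\in\mathcal{U}$ is deterministic. Model-based controller (no exploration): $u_k=w_k$, $y_k=h(u_k,d_k)$,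 $w_{k+1}=\mathrm{Proj}_{\mathcal{U}}\big(w_k-\eta(\nabla_u\Phi_k(u_k,y_k)+\hat H_k\nabla_y\Phi_k(u_k,y_k))\big)$, where $\hat H_k\in\mathbb{R}^{p\times q}$ are approximate sensitivities with error $\epsilon_{H,k}=\|\hat H_k-\nabla_uh(u_k,d_k)\|$. Here everything is deterministic, so the expectation in the regret is trivial. Model-free controller: with i.i.d. $v_0,v_1,\dots$ uniform on the unit sphere of $\mathbb{R}^p$, $u_k=w_k+\delta v_k$, $y_k=h(u_k,d_k)$, $w_{k+1}=\mathrm{Proj}_{\mathcal{U}}(w_k-\eta\hat\phi_k)$, $\hat\phi_k=\frac{p\,v_k}{\delta}\big(\Phi_k(u_k,y_k)-\Phi_{k-1}(u_{k-1},y_{k-1})\big)$, where for $k=0$ the value $\Phi_{-1}(u_{-1},y_{-1})$ is a fixed deterministic initialization. $\mathbb{E}$ is expectation over all $v_j$. Convention for $\mathcal{O}$: the bound holds up to a multiplicative constant independent of $p$, $T$ and $C_T$ (it may depend on $\bar\epsilon,\bar\epsilon',\theta,G,\tau,D,\sup_{u\in\mathcal{U}}\|u\|,\sup_kL_k,\sup_kM_k,\sup_kM_{\Phi,k}$), for all sufficiently large $T$. *)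

theory Defs
  imports "HOL-Probability.Probability"
begin

section \<open>Euclidean spaces of variable dimension\<close>

text \<open>
  The constants hidden in the O-notation must not depend on the dimension, so dimensions have to be
  quantified inside a formula and cannot be types. All vectors therefore live in one ambient inner
  product space, the finitely supported real sequences with the Euclidean inner product, and
  n-dimensional Euclidean space is its subspace \<open>Rn n\<close> of the sequences supported in \<open>{..<n}\<close>.
  On \<open>Rn n\<close> the norm, topology and Borel sets of the ambient space are the usual ones.
\<close>

typedef c00 = "{x :: nat \<Rightarrow> real. finite {i. x i \<noteq> 0}}"
  morphisms coord Abs_c00
  by (rule exI[of _ "\<lambda>_. 0"]) simp

setup_lifting type_definition_c00

lemma finite_support: "finite {i. coord x i \<noteq> 0}"
  using coord[of x] by simp

lemma c00_eqI: "(\<And>i. coord x i = coord y i) \<Longrightarrow> x = y"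
  by (simp add: coord_inject[symmetric] fun_eq_iff)

instantiation c00 :: real_vector
begin

lift_definition zero_c00 :: c00 is "\<lambda>_. 0" by simp

lift_definition plus_c00 :: "c00 \<Rightarrow> c00 \<Rightarrow> c00" is "\<lambda>x y i. x i + y i"
  by (rule finite_subset[rotated], erule (1) finite_UnI) auto

lift_definition uminus_c00 :: "c00 \<Rightarrow> c00" is "\<lambda>x i. - x i" by simp

lift_definition minus_c00 :: "c00 \<Rightarrow> c00 \<Rightarrow> c00" is "\<lambda>x y i. x i - y i"
  by (rule finite_subset[rotated], erule (1) finite_UnI) auto

lift_definition scaleR_c00 :: "real \<Rightarrow> c00 \<Rightarrow> c00" is "\<lambda>a x i. a * x i"
  by (rule finite_subset[rotated], assumption) auto

instance
  by (standard; transfer) (auto simp: fun_eq_iff algebra_simps)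

end

instantiation c00 :: real_inner
begin

definition inner_c00 :: "c00 \<Rightarrow> c00 \<Rightarrow> real"
  where "inner_c00 x y = (\<Sum>i | coord x i \<noteq> 0. coord x i * coord y i)"

definition norm_c00 :: "c00 \<Rightarrow> real"
  where "norm_c00 x = sqrt (x \<bullet> x)"

definition dist_c00 :: "c00 \<Rightarrow> c00 \<Rightarrow> real"
  where "dist_c00 x y = norm (x - y)"

definition sgn_c00 :: "c00 \<Rightarrow> c00"
  where "sgn_c00 x = x /\<^sub>R norm x"

definition uniformity_c00 :: "(c00 \<times> c00) filter"
  where "uniformity_c00 = (INF e\<in>{0<..}. principal {(x, y). dist x y < e})"

definition open_c00 :: "c00 set \<Rightarrow> bool"
  where "open_c00 S \<longleftrightarrow> (\<forall>x\<in>S. \<forall>\<^sub>F (x', y) in uniformity. x' = x \<longrightarrow> y \<in> S)"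

lemma inner_c00_on:
  assumes "finite S" "{i. coord x i \<noteq> 0} \<subseteq> S"
  shows "x \<bullet> y = (\<Sum>i\<in>S. coord x i * coord y i)"
  unfolding inner_c00_def by (rule sum.mono_neutral_left) (use assms in auto)

instance
proof
  fix x y z :: c00 and r :: real
  let ?S = "{i. coord x i \<noteq> 0} \<union> {i. coord y i \<noteq> 0}"
  have fin: "finite ?S"
    by (simp add: finite_support)
  have x: "x \<bullet> v = (\<Sum>i\<in>?S. coord x i * coord v i)" for v
    by (rule inner_c00_on) (use fin in auto)
  have y: "y \<bullet> v = (\<Sum>i\<in>?S. coord y i * coord v i)" for v
    by (rule inner_c00_on) (use fin in auto)
  show "dist x y = norm (x - y)"
    by (fact dist_c00_def)
  show "sgn x = x /\<^sub>R norm x"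
    by (fact sgn_c00_def)
  show "uniformity = (INF e\<in>{0<..}. principal {(x, y::c00). dist x y < e})"
    by (fact uniformity_c00_def)
  show "open S \<longleftrightarrow> (\<forall>x\<in>S. \<forall>\<^sub>F (x', y) in uniformity. x' = x \<longrightarrow> y \<in> S)" for S :: "c00 set"
    by (fact open_c00_def)
  show "x \<bullet> y = y \<bullet> x"
    by (simp add: x y mult.commute)
  have "(x + y) \<bullet> z = (\<Sum>i\<in>?S. coord (x + y) i * coord z i)"
    by (rule inner_c00_on) (use fin in \<open>auto simp: plus_c00.rep_eq\<close>)
  then show "(x + y) \<bullet> z = x \<bullet> z + y \<bullet> z"
    by (simp add: x y plus_c00.rep_eq distrib_right sum.distrib)
  have "(r *\<^sub>R x) \<bullet> y = (\<Sum>i\<in>?S. coord (r *\<^sub>R x) i * coord y i)"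
    by (rule inner_c00_on) (use fin in \<open>auto simp: scaleR_c00.rep_eq\<close>)
  then show "(r *\<^sub>R x) \<bullet> y = r * (x \<bullet> y)"
    by (simp add: x scaleR_c00.rep_eq sum_distrib_left mult.assoc)
  show "0 \<le> x \<bullet> x"
    by (simp add: inner_c00_def sum_nonneg)
  have "x \<bullet> x = 0 \<longleftrightarrow> (\<forall>i. coord x i = 0)"
    by (auto simp: inner_c00_def finite_support sum_nonneg_eq_0_iff)
  also have "\<dots> \<longleftrightarrow> x = 0"
    by (auto intro: c00_eqI simp: zero_c00.rep_eq)
  finally show "x \<bullet> x = 0 \<longleftrightarrow> x = 0" .
  show "norm x = sqrt (x \<bullet> x)"
    by (fact norm_c00_def)
qed

end

definition Rn :: "nat \<Rightarrow> c00 set"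
  where "Rn n = {x. \<forall>i\<ge>n. coord x i = 0}"

lift_definition rvec :: "nat \<Rightarrow> (nat \<Rightarrow> real) \<Rightarrow> c00" is "\<lambda>n a i. if i < n then a i else 0"
  by (rule finite_subset[of _ "{..<n}" for n]) auto

definition unit_vec :: "nat \<Rightarrow> c00"
  where "unit_vec i = rvec (Suc i) (\<lambda>j. if j = i then 1 else 0)"

definition grad :: "nat \<Rightarrow> (c00 \<Rightarrow> real) \<Rightarrow> c00 \<Rightarrow> c00"
  where "grad n f x = rvec n (\<lambda>i. deriv (\<lambda>t. f (x + t *\<^sub>R unit_vec i)) 0)"

text \<open>
  A p-by-q matrix is a function of two indices of which only the entries \<open>i < p\<close>, \<open>j < q\<close> matter.
  \<open>mat_vec p q A\<close> ignores all coordinates of its argument beyond \<open>q\<close>, so that its \<open>onorm\<close> over the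
  whole ambient space is the spectral norm of the p-by-q matrix.
\<close>

definition mat_vec :: "nat \<Rightarrow> nat \<Rightarrow> (nat \<Rightarrow> nat \<Rightarrow> real) \<Rightarrow> c00 \<Rightarrow> c00"
  where "mat_vec p q A x = rvec p (\<lambda>i. \<Sum>j<q. A i j * coord x j)"

definition mat_norm :: "nat \<Rightarrow> nat \<Rightarrow> (nat \<Rightarrow> nat \<Rightarrow> real) \<Rightarrow> real"
  where "mat_norm p q A = onorm (mat_vec p q A)"

definition jacobian_transp :: "(c00 \<Rightarrow> c00) \<Rightarrow> c00 \<Rightarrow> nat \<Rightarrow> nat \<Rightarrow> real"
  where "jacobian_transp f x i j = deriv (\<lambda>t. coord (f (x + t *\<^sub>R unit_vec i)) j) 0"

text \<open>The library's \<open>closest_point\<close> requires the Heine-Borel property of the ambient type.\<close>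

definition proj :: "c00 set \<Rightarrow> c00 \<Rightarrow> c00"
  where "proj S x = arg_min (\<lambda>y. dist x y) (\<lambda>y. y \<in> S)"

definition unit_sphere :: "nat \<Rightarrow> c00 set"
  where "unit_sphere n = {x \<in> Rn n. norm x = 1}"

text \<open>
  The radial projection of the uniform distribution on the unit ball is the uniform distribution on
  the unit sphere. The space of the measure is cut down to the sphere because the functions
  integrated later are constrained, and hence measurable, only there.
\<close>

definition uniform_sphere :: "nat \<Rightarrow> c00 measure"
  where "uniform_sphere n =
    (let R = (\<Pi>\<^sub>M i\<in>{..<n}. (lborel :: real measure)) in
     restrict_space
       (distr (uniform_measure R {a \<in> space R. norm (rvec n a) \<le> 1}) borel (\<lambda>a. sgn (rvec n a)))
       (unit_sphere n))"


section \<open>Problem and standing assumptions\<close>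

definition reduced ::
    "(nat \<Rightarrow> c00 \<Rightarrow> c00 \<Rightarrow> real) \<Rightarrow> (c00 \<Rightarrow> c00 \<Rightarrow> c00) \<Rightarrow> (nat \<Rightarrow> c00) \<Rightarrow> nat \<Rightarrow> c00 \<Rightarrow> real"
  where "reduced \<Phi> h d k u = \<Phi> k u (h u (d k))"

definition plant ::
    "nat \<Rightarrow> nat \<Rightarrow> nat \<Rightarrow> (nat \<Rightarrow> c00 \<Rightarrow> c00 \<Rightarrow> real) \<Rightarrow> (c00 \<Rightarrow> c00 \<Rightarrow> c00) \<Rightarrow> (nat \<Rightarrow> c00) \<Rightarrow> bool"
  where "plant p q r \<Phi> h d \<longleftrightarrow>
    0 < p \<and> 0 < q \<and> 0 < r \<and>
    (\<forall>k. (\<lambda>(u, y). \<Phi> k u y) differentiable_on (Rn p \<times> Rn q)) \<and>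
    (\<forall>k. d k \<in> Rn r) \<and>
    (\<forall>u\<in>Rn p. \<forall>e\<in>Rn r. h u e \<in> Rn q)"

definition differentiable_steady_state_map :: "nat \<Rightarrow> nat \<Rightarrow> (c00 \<Rightarrow> c00 \<Rightarrow> c00) \<Rightarrow> bool"
  where "differentiable_steady_state_map p r h \<longleftrightarrow> (\<forall>e\<in>Rn r. (\<lambda>u. h u e) differentiable_on Rn p)"

definition constraint_set :: "nat \<Rightarrow> c00 set \<Rightarrow> real \<Rightarrow> bool"
  where "constraint_set p U D \<longleftrightarrow>
    U \<subseteq> Rn p \<and> compact U \<and> convex U \<and> 0 < D \<and> (\<forall>u\<in>U. \<forall>u'\<in>U. norm (u - u') \<le> D)"

definition regular_objectives ::
    "nat \<Rightarrow> nat \<Rightarrow> (nat \<Rightarrow> c00 \<Rightarrow> c00 \<Rightarrow> real) \<Rightarrow> (c00 \<Rightarrow> c00 \<Rightarrow> c00) \<Rightarrow> (nat \<Rightarrow> c00) \<Rightarrow>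
     (nat \<Rightarrow> real) \<Rightarrow> (nat \<Rightarrow> real) \<Rightarrow> (nat \<Rightarrow> real) \<Rightarrow> bool"
  where "regular_objectives p q \<Phi> h d L M M\<Phi> \<longleftrightarrow>
    (\<forall>k. convex_on (Rn p) (reduced \<Phi> h d k) \<and>
         (L k)-lipschitz_on (Rn p) (grad p (reduced \<Phi> h d k)) \<and>
         (M k)-lipschitz_on (Rn p) (reduced \<Phi> h d k) \<and>
         (\<forall>u\<in>Rn p. (M\<Phi> k)-lipschitz_on (Rn q) (\<Phi> k u))) \<and>
    bounded (range L) \<and> bounded (range M) \<and> bounded (range M\<Phi>)"

definition bounded_objectives ::
    "nat \<Rightarrow> c00 set \<Rightarrow> (nat \<Rightarrow> c00 \<Rightarrow> c00 \<Rightarrow> real) \<Rightarrow> (c00 \<Rightarrow> c00 \<Rightarrow> c00) \<Rightarrow> (nat \<Rightarrow> c00) \<Rightarrow>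
     real \<Rightarrow> real \<Rightarrow> bool"
  where "bounded_objectives p U \<Phi> h d G \<tau> \<longleftrightarrow>
    0 \<le> G \<and> 0 < \<tau> \<and>
    (\<forall>k. \<forall>u \<in> {u + \<tau> *\<^sub>R v | u v. u \<in> U \<and> v \<in> Rn p \<and> norm v \<le> 1}. \<bar>reduced \<Phi> h d k u\<bar> \<le> G)"

text \<open>
  The plant together with all standing assumptions; \<open>us\<close> is any selection of minimizers, and the
  last three lines name the quantities besides \<open>G\<close>, \<open>\<tau>\<close>, \<open>D\<close> on which the constants may depend.
\<close>

definition setting ::
    "nat \<Rightarrow> nat \<Rightarrow> nat \<Rightarrow> c00 set \<Rightarrow> (nat \<Rightarrow> c00 \<Rightarrow> c00 \<Rightarrow> real) \<Rightarrow> (c00 \<Rightarrow> c00 \<Rightarrow> c00) \<Rightarrow>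
     (nat \<Rightarrow> c00) \<Rightarrow> (nat \<Rightarrow> c00) \<Rightarrow> real \<Rightarrow> real \<Rightarrow> real \<Rightarrow> real \<Rightarrow> real \<Rightarrow> real \<Rightarrow> real \<Rightarrow> bool"
  where "setting p q r U \<Phi> h d us G \<tau> D Rsup Lsup Msup M\<Phi>sup \<longleftrightarrow>
    plant p q r \<Phi> h d \<and>
    differentiable_steady_state_map p r h \<and>
    constraint_set p U D \<and>
    bounded_objectives p U \<Phi> h d G \<tau> \<and>
    (\<forall>k. is_arg_min (reduced \<Phi> h d k) (\<lambda>u. u \<in> U) (us k)) \<and>
    Rsup = (SUP u\<in>U. norm u) \<and>
    (\<exists>L M M\<Phi>. regular_objectives p q \<Phi> h d L M M\<Phi> \<and>
       Lsup = (SUP k. L k) \<and> Msup = (SUP k. M k) \<and> M\<Phi>sup = (SUP k. M\<Phi> k))"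


section \<open>Controllers and regret\<close>

definition model_based_loop ::
    "nat \<Rightarrow> nat \<Rightarrow> c00 set \<Rightarrow> (nat \<Rightarrow> c00 \<Rightarrow> c00 \<Rightarrow> real) \<Rightarrow> (c00 \<Rightarrow> c00 \<Rightarrow> c00) \<Rightarrow> (nat \<Rightarrow> c00) \<Rightarrow>
     real \<Rightarrow> (nat \<Rightarrow> nat \<Rightarrow> nat \<Rightarrow> real) \<Rightarrow> (nat \<Rightarrow> c00) \<Rightarrow> (nat \<Rightarrow> c00) \<Rightarrow> (nat \<Rightarrow> c00) \<Rightarrow> bool"
  where "model_based_loop p q U \<Phi> h d \<eta> H w u y \<longleftrightarrow>
    w 0 \<in> U \<and>
    (\<forall>k. u k = w k \<and>
         y k = h (u k) (d k) \<and>
         w (Suc k) = proj U (w k - \<eta> *\<^sub>R (grad p (\<lambda>u'. \<Phi> k u' (y k)) (u k)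
                                       + mat_vec p q (H k) (grad q (\<lambda>y'. \<Phi> k (u k) y') (y k)))))"

definition sensitivity_error ::
    "nat \<Rightarrow> nat \<Rightarrow> (c00 \<Rightarrow> c00 \<Rightarrow> c00) \<Rightarrow> (nat \<Rightarrow> c00) \<Rightarrow> (nat \<Rightarrow> nat \<Rightarrow> nat \<Rightarrow> real) \<Rightarrow>
     (nat \<Rightarrow> c00) \<Rightarrow> nat \<Rightarrow> real"
  where "sensitivity_error p q h d H u k =
    mat_norm p q (\<lambda>i j. H k i j - jacobian_transp (\<lambda>u'. h u' (d k)) (u k) i j)"

text \<open>One sample path of the model-free loop, for the realization \<open>v\<close> of the exploration noise;
  \<open>\<phi>0\<close> is the initialization that replaces the measurement before time 0.\<close>

definition model_free_loop ::
    "nat \<Rightarrow> c00 set \<Rightarrow> (nat \<Rightarrow> c00 \<Rightarrow> c00 \<Rightarrow> real) \<Rightarrow> (c00 \<Rightarrow> c00 \<Rightarrow> c00) \<Rightarrow> (nat \<Rightarrow> c00) \<Rightarrow>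
     real \<Rightarrow> real \<Rightarrow> c00 \<Rightarrow> real \<Rightarrow> (nat \<Rightarrow> c00) \<Rightarrow> (nat \<Rightarrow> c00) \<Rightarrow> (nat \<Rightarrow> c00) \<Rightarrow> (nat \<Rightarrow> c00) \<Rightarrow> bool"
  where "model_free_loop p U \<Phi> h d \<eta> \<delta> w0 \<phi>0 v w u y \<longleftrightarrow>
    w 0 = w0 \<and>
    (\<forall>k. u k = w k + \<delta> *\<^sub>R v k \<and>
         y k = h (u k) (d k) \<and>
         (let prev = (case k of 0 \<Rightarrow> \<phi>0 | Suc j \<Rightarrow> \<Phi> j (u j) (y j));
              \<phi> = (real p / \<delta> * (\<Phi> k (u k) (y k) - prev)) *\<^sub>R v k
          in w (Suc k) = proj U (w k - \<eta> *\<^sub>R \<phi>)))"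

definition exploration :: "nat \<Rightarrow> (nat \<Rightarrow> c00) measure"
  where "exploration p = (\<Pi>\<^sub>M k\<in>UNIV. uniform_sphere p)"

text \<open>\<open>J k\<close> is the (expected) cost incurred at time \<open>k\<close>.\<close>

definition dynamic_regret ::
    "(nat \<Rightarrow> c00 \<Rightarrow> real) \<Rightarrow> (nat \<Rightarrow> real) \<Rightarrow> (nat \<Rightarrow> c00) \<Rightarrow> nat \<Rightarrow> real"
  where "dynamic_regret f J us T = (\<Sum>k=1..T. J k - f k (us k))"

definition path_length :: "(nat \<Rightarrow> c00) \<Rightarrow> nat \<Rightarrow> real"
  where "path_length us T = (\<Sum>k=1..T. norm (us k - us (k - 1)))"

text \<open>
  The two O-claims. In both, \<open>C\<close> and \<open>T0\<close> are chosen before the dimensions, the problem instance,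
  the horizon and the trajectories. In the first, \<open>e\<close> bounds the sensitivity errors and \<open>rate T CT\<close>
  is the asserted growth.
\<close>

definition model_based_regret_bound ::
    "(nat \<Rightarrow> real) \<Rightarrow> (nat \<Rightarrow> real \<Rightarrow> real) \<Rightarrow>
     real \<Rightarrow> real \<Rightarrow> real \<Rightarrow> real \<Rightarrow> real \<Rightarrow> real \<Rightarrow> real \<Rightarrow> bool"
  where "model_based_regret_bound e rate G \<tau> D Rsup Lsup Msup M\<Phi>sup \<longleftrightarrow>
    (\<exists>C T0. \<forall>p q r U \<Phi> h d us T H w u y.
       setting p q r U \<Phi> h d us G \<tau> D Rsup Lsup Msup M\<Phi>sup \<longrightarrow>
       0 < T \<longrightarrow> T0 \<le> T \<longrightarrow>
       model_based_loop p q U \<Phi> h d (1 / sqrt (real T)) H w u y \<longrightarrow>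
       (\<forall>k. sensitivity_error p q h d H u k \<le> e k) \<longrightarrow>
       dynamic_regret (reduced \<Phi> h d) (\<lambda>k. reduced \<Phi> h d k (w k)) us T
         \<le> C * rate T (path_length us T))"

definition model_free_regret_bound ::
    "real \<Rightarrow> real \<Rightarrow> real \<Rightarrow> real \<Rightarrow> real \<Rightarrow> real \<Rightarrow> real \<Rightarrow> bool"
  where "model_free_regret_bound G \<tau> D Rsup Lsup Msup M\<Phi>sup \<longleftrightarrow>
    (\<exists>C T0. \<forall>p q r U \<Phi> h d us T w0 \<phi>0 w u y.
       setting p q r U \<Phi> h d us G \<tau> D Rsup Lsup Msup M\<Phi>sup \<longrightarrow>
       0 < T \<longrightarrow> T0 \<le> T \<longrightarrow>
       w0 \<in> U \<longrightarrow>
       (\<forall>v \<in> space (exploration p).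
          model_free_loop p U \<Phi> h d
            (1 / (real p powr (2/3) * real T powr (2/3)))
            (min (real p powr (1/3) / real T powr (1/6)) \<tau>)
            w0 \<phi>0 v (w v) (u v) (y v)) \<longrightarrow>
       dynamic_regret (reduced \<Phi> h d)
           (\<lambda>k. \<integral>v. reduced \<Phi> h d k (w v k) \<partial>exploration p) us T
         \<le> C * (real p powr (2/3) * real T powr (2/3) * (path_length us T + 1)))"

end

theory Submission
  imports Defs
begin

text \<open>
  Both controllers are projected gradient iterations with estimates \<open>g k\<close>, for which summing
  \<open>(norm (w (k + 1) - us k))\<^sup>2 \<le> (norm (w k - \<eta> g k - us k))\<^sup>2\<close> bounds \<open>\<Sum>k. g k \<bullet> (w k - us k)\<close> by
  \<open>(D\<^sup>2 + 2 D C\<^sub>T) / (2 \<eta>) + \<eta> / 2 * (\<Sum>k. (norm (g k))\<^sup>2)\<close>.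

  In the model-based case convexity bounds the regret at time \<open>k\<close> by the inner product with the true
  gradient, which by the chain rule differs from \<open>g k\<close> by at most \<open>M\<Phi>\<close> times the sensitivity error.

  In the model-free case \<open>norm (g k) \<le> 2 G p / \<delta>\<close>, and resampling \<open>v k\<close> shows that the expected inner
  product is at least the regret at time \<open>k\<close> minus \<open>L \<delta>\<^sup>2\<close>. This rests on a one-sided form of the
  divergence theorem for convex \<open>f\<close>: the mean of \<open>f x - f (x - z)\<close> over the unit ball is at most
  \<open>n\<close> times the mean of \<open>f v * (v \<bullet> z)\<close> over the unit sphere. If \<open>\<delta>\<close> is capped at \<open>\<tau>\<close>, then
  \<open>T \<le> (p T)\<^sup>2\<^sup>/\<^sup>3 / \<tau>\<^sup>2\<close> and the trivial bound \<open>2 G T\<close> suffices.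
\<close>

section \<open>The ambient sequence space\<close>

text \<open>The parameters of the model-free controller balance three terms:
  \<open>1 / \<eta>\<close> from the comparator, \<open>\<eta> T p^2 / \<delta>^2\<close> from the
  squared estimates and \<open>T \<delta>^2\<close> from the bias. Without the cap on
  \<open>\<delta>\<close> each is of order \<open>(p T)^(2/3)\<close>. A bias of order
  \<open>\<delta>\<close> would contribute \<open>p^(1/3) T^(5/6)\<close>, too much for fixed
  \<open>p\<close>, so the quadratic bias is essential.

  Only an upper bound on the regret against a fixed comparator is wanted, so the exact divergence
  identity can give way to an inequality about finite differences, and no derivative of
  \<open>f\<close> is integrated. The sphere measure is a radial projection of the ball measure;
  hence sphere integrals are read as ball integrals of \<open>f (sgn x)\<close>, and volumes enter
  only through the scaling law \<open>r ^ n\<close>.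

  Both regret sums start at \<open>k = 1\<close>. Time 0 therefore only produces another point of
  \<open>U\<close>, and the arbitrary initialization \<open>\<phi>0\<close> enters no
  constant.\<close>

lemma coord_simps [simp]:
  "coord 0 i = 0" "coord (x + y) i = coord x i + coord y i" "coord (- x) i = - coord x i"
  "coord (x - y) i = coord x i - coord y i" "coord (a *\<^sub>R x) i = a * coord x i"
  "coord (rvec n f) i = (if i < n then f i else 0)" "coord (unit_vec j) i = (if i = j then 1 else 0)"
  by (simp_all add: zero_c00.rep_eq plus_c00.rep_eq uminus_c00.rep_eq minus_c00.rep_eq
      scaleR_c00.rep_eq rvec.rep_eq unit_vec_def)

lemma coord_sum [simp]: "coord (\<Sum>i\<in>A. f i) j = (\<Sum>i\<in>A. coord (f i) j)"
  by (induction A rule: infinite_finite_induct) auto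

lemma inner_Rn: "x \<in> Rn n \<Longrightarrow> x \<bullet> y = (\<Sum>i<n. coord x i * coord y i)"
  by (rule inner_c00_on) (auto simp: Rn_def not_less[symmetric])

lemma inner_Rn': "y \<in> Rn n \<Longrightarrow> x \<bullet> y = (\<Sum>i<n. coord x i * coord y i)"
  using inner_Rn[of y n x] by (simp add: inner_commute mult.commute)

lemma rvec_in_Rn [simp]: "rvec n f \<in> Rn n"
  by (simp add: Rn_def)

lemma unit_vec_in_Rn [simp]: "unit_vec i \<in> Rn n \<longleftrightarrow> i < n"
  by (auto simp: Rn_def not_less)

lemma subspace_Rn: "subspace (Rn n)"
  by (auto simp: subspace_def Rn_def)

lemma rvec_coord: "x \<in> Rn n \<Longrightarrow> rvec n (coord x) = x"
  by (rule c00_eqI) (auto simp: Rn_def)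

lemma rvec_eq_sum: "rvec n f = (\<Sum>i<n. f i *\<^sub>R unit_vec i)"
  by (rule c00_eqI) (simp add: if_distrib[of "\<lambda>x. _ * x"] sum.delta' cong: if_cong)

lemma coord_eq_inner: "coord x i = x \<bullet> unit_vec i"
  by (subst inner_Rn'[of _ "Suc i"]) (auto simp: if_distrib[of "\<lambda>x. _ * x"] sum.delta' cong: if_cong)

lemma norm_unit_vec [simp]: "norm (unit_vec i) = 1"
  using coord_eq_inner[of "unit_vec i" i] by (simp add: norm_eq_sqrt_inner)

lemma abs_coord_le: "\<bar>coord x i\<bar> \<le> norm x"
  using Cauchy_Schwarz_ineq2[of x "unit_vec i"] by (simp add: coord_eq_inner)

lemma bounded_linear_coord: "bounded_linear (\<lambda>x. coord x i)"
  unfolding coord_eq_inner by (rule bounded_linear_inner_left)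

lemma rvec_inner: "rvec n f \<bullet> y = (\<Sum>i<n. f i * coord y i)"
  by (simp add: inner_Rn[of _ n])

lemma norm_rvec_coord_le: "norm (rvec n (coord x)) \<le> norm x"
proof -
  let ?P = "rvec n (coord x)"
  have "?P \<bullet> ?P = ?P \<bullet> x" by (simp add: rvec_inner)
  then have "norm ?P * norm ?P \<le> norm ?P * norm x"
    using norm_cauchy_schwarz[of ?P x] by (simp add: power2_norm_eq_inner[symmetric] power2_eq_square)
  then show ?thesis by (cases "norm ?P = 0") (auto simp: mult_le_cancel_left)
qed

lemma bounded_linear_rvec_coord: "bounded_linear (\<lambda>x. rvec n (coord x))"
  by (rule bounded_linear_intro[where K = 1]) (auto intro!: c00_eqI simp: norm_rvec_coord_le)

lemma closed_Rn: "closed (Rn n)"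
proof -
  have "Rn n = {x. rvec n (coord x) = x}"
    using rvec_coord[of _ n] by (auto intro: subst[of _ _ "\<lambda>x. x \<in> Rn n", OF _ rvec_in_Rn])
  then show ?thesis
    by (auto intro!: closed_Collect_eq linear_continuous_on bounded_linear_rvec_coord continuous_on_id)
qed

lemma Rn_exhaust: "\<exists>n. x \<in> Rn n"
proof -
  obtain n where "\<forall>i\<in>{i. coord x i \<noteq> 0}. i < n"
    using finite_nat_set_iff_bounded finite_support[of x] by auto
  then have "x \<in> Rn n" by (force simp: Rn_def)
  then show ?thesis ..
qed

section \<open>Separability of the ambient space\<close>

lemma c00_countable_dense:
  obtains C :: "c00 set" where "countable C" "\<And>x e. 0 < e \<Longrightarrow> \<exists>c\<in>C. dist x c < e"
proof
  let ?g = "\<lambda>qs :: rat list. rvec (length qs) (\<lambda>i. of_rat (qs ! i))"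
  show "countable (range ?g)" by simp
  fix x :: c00 and e :: real assume e: "0 < e"
  obtain n where n: "x \<in> Rn n" using Rn_exhaust by blast
  \<comment> \<open>The \<open>+ 1\<close> keeps the tolerance finite for \<open>n = 0\<close> and
    the sum of the \<open>n\<close> errors strictly below \<open>e\<close>.\<close>
  have "\<exists>q. \<bar>coord x i - of_rat q\<bar> < e / (real n + 1)" for i
  proof -
    have "0 < e / (real n + 1)" using e by simp
    then obtain q where "coord x i - e / (real n + 1) < of_rat q" "of_rat q < coord x i + e / (real n + 1)"
      using of_rat_dense[of "coord x i - e / (real n + 1)" "coord x i + e / (real n + 1)"] by auto
    then show ?thesis by (intro exI[of _ q]) (simp add: abs_less_iff)
  qed
  then obtain q where q: "\<And>i. \<bar>coord x i - of_rat (q i)\<bar> < e / (real n + 1)" by metis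
  let ?c = "?g (map q [0..<n])"
  have "x - ?c = (\<Sum>i<n. (coord x i - of_rat (q i)) *\<^sub>R unit_vec i)"
    using n by (auto intro!: c00_eqI simp: Rn_def if_distrib[of "\<lambda>x. _ * x"] sum.delta' cong: if_cong)
  then have "dist x ?c \<le> (\<Sum>i<n. norm ((coord x i - of_rat (q i)) *\<^sub>R unit_vec i))"
    by (simp only: dist_norm norm_sum)
  also have "\<dots> \<le> (\<Sum>i<n. e / (real n + 1))"
    using q by (intro sum_mono) (auto intro: less_imp_le)
  also have "\<dots> < e" using e by (simp add: field_simps)
  finally show "\<exists>c\<in>range ?g. dist x c < e" by blast
qed

text \<open>Measurability of sums, differences and inner products of measurable maps into
  \<open>c00\<close> rests on second countability, since it makes the Borel sets of a product those
  generated by the factors.\<close>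

instance c00 :: second_countable_topology
proof
  obtain C :: "c00 set" where C: "countable C" "\<And>x e. 0 < e \<Longrightarrow> \<exists>c\<in>C. dist x c < e"
    using c00_countable_dense by blast
  define B where "B = (\<lambda>(c, m). ball c (inverse (real (Suc m)))) ` (C \<times> (UNIV :: nat set))"
  have "topological_basis B"
  proof (rule topological_basisI)
    fix S x assume "open S" "(x :: c00) \<in> S"
    then obtain e where e: "0 < e" "ball x e \<subseteq> S" by (auto simp: open_contains_ball)
    obtain m where m: "inverse (real (Suc m)) < e / 2" using reals_Archimedean[of "e/2"] e by auto
    obtain c where c: "c \<in> C" "dist x c < inverse (real (Suc m))"
      using C(2)[of "inverse (real (Suc m))" x] by auto
    have "ball c (inverse (real (Suc m))) \<subseteq> ball x e"
    proof
      fix y assume y: "y \<in> ball c (inverse (real (Suc m)))"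
      have "dist x y \<le> dist x c + dist c y" by (rule dist_triangle)
      then show "y \<in> ball x e" using c(2) m y by simp
    qed
    then show "\<exists>B'\<in>B. x \<in> B' \<and> B' \<subseteq> S"
      using e c by (intro bexI[of _ "ball c (inverse (real (Suc m)))"]) (auto simp: B_def dist_commute)
  qed (auto simp: B_def)
  moreover have "countable B" unfolding B_def using C(1) by blast
  ultimately show "\<exists>B :: c00 set set. countable B \<and> open = generate_topology B"
    using topological_basis_imp_subbasis by blast
qed

lemma rvec_measurable [measurable]: "rvec n \<in> borel_measurable (\<Pi>\<^sub>M i\<in>{..<n}. lborel)"
proof -
  have "(\<lambda>f. \<Sum>i<n. f i *\<^sub>R unit_vec i) \<in> borel_measurable (\<Pi>\<^sub>M i\<in>{..<n}. lborel)"
    by measurable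
  then show ?thesis by (simp add: rvec_eq_sum[abs_def])
qed

section \<open>Projected gradient descent\<close>

text \<open>Compactness makes the minimum distance attained, so the choice inside
  \<open>arg_min\<close> picks a genuine nearest point.\<close>

lemma proj_nearest:
  assumes "compact U" "U \<noteq> {}"
  shows "proj U x \<in> U" "\<And>y. y \<in> U \<Longrightarrow> dist x (proj U x) \<le> dist x y"
proof -
  have "continuous_on U (\<lambda>y. dist x y)" by (intro continuous_intros)
  then obtain m where "m \<in> U" "\<forall>y\<in>U. dist x m \<le> dist x y"
    using continuous_attains_inf assms by blast
  then have "is_arg_min (\<lambda>y. dist x y) (\<lambda>y. y \<in> U) m"
    by (auto simp: is_arg_min_def not_less)
  then have "is_arg_min (\<lambda>y. dist x y) (\<lambda>y. y \<in> U) (proj U x)"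
    unfolding proj_def arg_min_def by (rule someI)
  then show "proj U x \<in> U" "\<And>y. y \<in> U \<Longrightarrow> dist x (proj U x) \<le> dist x y"
    by (auto simp: is_arg_min_def not_less)
qed

lemma proj_inner_le:
  assumes "compact U" "convex U" "y \<in> U"
  shows "(x - proj U x) \<bullet> (y - proj U x) \<le> 0"
proof -
  have "U \<noteq> {}" using assms by auto
  then show ?thesis
    using assms proj_nearest[OF assms(1)]
    by (intro any_closest_point_dot[of U]) (auto simp: compact_imp_closed)
qed

text \<open>The obtuse-angle inequalities at the two projections are added and Cauchy-Schwarz is
  applied. Besides the descent step this yields continuity, hence measurability, of the
  projection.\<close>

lemma proj_nonexpansive:
  assumes "compact U" "convex U" "U \<noteq> {}"
  shows "norm (proj U x - proj U y) \<le> norm (x - y)"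
proof -
  let ?a = "proj U x" and ?b = "proj U y"
  have "(x - ?a) \<bullet> (?b - ?a) \<le> 0" "(y - ?b) \<bullet> (?a - ?b) \<le> 0"
    using assms proj_nearest by (auto intro!: proj_inner_le)
  then have "(?a - ?b) \<bullet> (?a - ?b) \<le> (x - y) \<bullet> (?a - ?b)"
    by (simp add: algebra_simps inner_commute)
  also have "\<dots> \<le> norm (x - y) * norm (?a - ?b)" by (rule norm_cauchy_schwarz)
  finally have "norm (?a - ?b) * norm (?a - ?b) \<le> norm (x - y) * norm (?a - ?b)"
    by (simp add: dot_square_norm power2_eq_square)
  then show ?thesis by (cases "norm (?a - ?b) = 0") (auto simp: mult_le_cancel_right)
qed

lemma proj_norm_le:
  assumes "compact U" "convex U" "y \<in> U"
  shows "norm (proj U x - y) \<le> norm (x - y)"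
proof -
  have "U \<noteq> {}" using assms by auto
  moreover have "proj U y = y" using proj_nearest(2)[of U y y] assms by force
  ultimately show ?thesis using proj_nonexpansive[of U x y] assms by simp
qed

lemma proj_measurable:
  assumes "compact U" "convex U" "U \<noteq> {}"
  shows "proj U \<in> borel_measurable borel"
proof (rule borel_measurable_continuous_onI)
  have "1-lipschitz_on UNIV (proj U)"
    using proj_nonexpansive[OF assms] by (auto intro!: lipschitz_onI simp: dist_norm)
  then show "continuous_on UNIV (proj U)" by (rule lipschitz_on_continuous_on)
qed

lemma projected_gradient_regret:
  fixes g us w :: "nat \<Rightarrow> c00"
  assumes U: "compact U" "convex U" "\<And>u u'. u \<in> U \<Longrightarrow> u' \<in> U \<Longrightarrow> norm (u - u') \<le> D"
    and us: "\<And>k. us k \<in> U" and w0: "w 0 \<in> U"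
    and w: "\<And>k. w (Suc k) = proj U (w k - \<eta> *\<^sub>R g k)" and \<eta>: "0 < \<eta>" and T: "0 < T"
  shows "(\<Sum>k=1..T. g k \<bullet> (w k - us k))
    \<le> (D\<^sup>2 + 2 * D * path_length us T) / (2 * \<eta>) + \<eta> / 2 * (\<Sum>k=1..T. (norm (g k))\<^sup>2)"
proof -
  have wU: "w k \<in> U" for k using w0 w proj_nearest(1) U(1) by (cases k) auto
  have D0: "0 \<le> D" using U(3)[OF us us, of 0 0] by simp
  define a where "a k = (norm (w k - us k))\<^sup>2" for k
  have step: "2 * \<eta> * (g k \<bullet> (w k - us k)) \<le> a k - (norm (w (Suc k) - us k))\<^sup>2 + \<eta>\<^sup>2 * (norm (g k))\<^sup>2" for k
  proof -
    have "(norm (w (Suc k) - us k))\<^sup>2 \<le> (norm (w k - \<eta> *\<^sub>R g k - us k))\<^sup>2"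
      unfolding w using U us by (intro power_mono proj_norm_le) auto
    also have "\<dots> = a k - 2 * \<eta> * (g k \<bullet> (w k - us k)) + \<eta>\<^sup>2 * (norm (g k))\<^sup>2"
      unfolding a_def power2_norm_eq_inner
      by (simp add: inner_diff_left inner_diff_right algebra_simps inner_commute power2_eq_square)
    finally show ?thesis by simp
  qed
  \<comment> \<open>Replacing the comparator \<open>us k\<close> by \<open>us (Suc k)\<close>
    changes a squared distance; as a difference of squares it is at most \<open>2 * D\<close> times
    the move of the comparator. This is the source of the path length.\<close>
  have drift: "a (Suc k) - (norm (w (Suc k) - us k))\<^sup>2 \<le> 2 * D * norm (us (Suc k) - us k)" for k
  proof -
    let ?x = "norm (w (Suc k) - us (Suc k))" and ?y = "norm (w (Suc k) - us k)"
    have "?x - ?y \<le> norm (us (Suc k) - us k)"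
      using norm_triangle_ineq2[of "w (Suc k) - us (Suc k)" "w (Suc k) - us k"]
      by (simp add: norm_minus_commute)
    moreover have "?x \<le> D" "?y \<le> D" using U(3) wU us by auto
    ultimately have "(?x + ?y) * (?x - ?y) \<le> (?x + ?y) * norm (us (Suc k) - us k)"
        "(?x + ?y) * norm (us (Suc k) - us k) \<le> (2 * D) * norm (us (Suc k) - us k)"
      by (auto intro!: mult_left_mono mult_right_mono)
    then show ?thesis by (simp add: a_def power2_eq_square algebra_simps)
  qed
  \<comment> \<open>The last negative square is kept in the induction claim: the next summand starts
    with \<open>a (Suc n)\<close>, and only its difference from that square is controlled by
    \<open>drift\<close>.\<close>
  have tele: "(\<Sum>k=1..n. a k - (norm (w (Suc k) - us k))\<^sup>2)
      \<le> D\<^sup>2 + 2 * D * path_length us n - (norm (w (Suc n) - us n))\<^sup>2" if "0 < n" for n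
    using that
  proof (induction n rule: nat_induct_non_zero)
    case 1
    have "a 1 \<le> D\<^sup>2" unfolding a_def using U(3) wU us by (intro power_mono) auto
    moreover have "0 \<le> D * norm (us 1 - us 0)" using D0 by simp
    ultimately show ?case by (simp add: path_length_def)
  next
    case (Suc n)
    then show ?case using drift[of n] by (simp add: path_length_def algebra_simps)
  qed
  have "2 * \<eta> * (\<Sum>k=1..T. g k \<bullet> (w k - us k))
      \<le> (\<Sum>k=1..T. a k - (norm (w (Suc k) - us k))\<^sup>2 + \<eta>\<^sup>2 * (norm (g k))\<^sup>2)"
    unfolding sum_distrib_left using step by (intro sum_mono)
  also have "\<dots> = (\<Sum>k=1..T. a k - (norm (w (Suc k) - us k))\<^sup>2) + \<eta>\<^sup>2 * (\<Sum>k=1..T. (norm (g k))\<^sup>2)"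
    by (simp add: sum.distrib sum_distrib_left)
  also have "\<dots> \<le> D\<^sup>2 + 2 * D * path_length us T + \<eta>\<^sup>2 * (\<Sum>k=1..T. (norm (g k))\<^sup>2)"
    using tele[OF T] zero_le_power2[of "norm (w (Suc T) - us T)"] by linarith
  finally show ?thesis using \<eta> by (simp add: field_simps power2_eq_square)
qed

section \<open>Lebesgue measure on Rn\<close>

text \<open>A measure on the ambient type that is concentrated on \<open>Rn n\<close>; the dimension
  stays a variable and functions on \<open>c00\<close> can be integrated directly.\<close>

definition lebesgue_Rn :: "nat \<Rightarrow> c00 measure"
  where "lebesgue_Rn n = distr (\<Pi>\<^sub>M i\<in>{..<n}. lborel) borel (rvec n)"

lemma sets_lebesgue_Rn [measurable_cong, simp]: "sets (lebesgue_Rn n) = sets borel"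
  by (simp add: lebesgue_Rn_def)

lemma space_lebesgue_Rn [simp]: "space (lebesgue_Rn n) = UNIV"
  by (simp add: lebesgue_Rn_def)

lemma AE_lebesgue_Rn: "AE x in lebesgue_Rn n. x \<in> Rn n"
proof -
  have [measurable]: "Rn n \<in> sets borel" using closed_Rn by (rule borel_closed)
  show ?thesis unfolding lebesgue_Rn_def by (subst AE_distr_iff) auto
qed

text \<open>Boxes determine the product measure, and a coordinatewise affine map pulls boxes back to
  boxes, so the one-dimensional law contributes a factor \<open>\<bar>c\<bar>\<close> for each
  coordinate.\<close>

lemma PiM_lborel_affine:
  fixes z :: "nat \<Rightarrow> real" and n :: nat
  assumes "c \<noteq> 0"
  defines "R \<equiv> \<Pi>\<^sub>M i\<in>{..<n}. (lborel :: real measure)"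
  defines "T \<equiv> \<lambda>f. \<lambda>i\<in>{..<n}. z i + c * f i"
  shows "R = density (distr R R T) (\<lambda>_. ennreal (\<bar>c\<bar> ^ n))"
  unfolding R_def
proof (rule product_sigma_finite.PiM_eqI[symmetric])
  show "product_sigma_finite (\<lambda>i::nat. lborel :: real measure)"
    by (simp add: product_sigma_finite_def sigma_finite_lborel)
  interpret product_sigma_finite "\<lambda>i::nat. lborel :: real measure" by fact
  have T [measurable]: "T \<in> R \<rightarrow>\<^sub>M R" unfolding R_def T_def by measurable
  fix A :: "nat \<Rightarrow> real set" assume A: "\<And>i. i \<in> {..<n} \<Longrightarrow> A i \<in> sets lborel"
  have AR: "Pi\<^sub>E {..<n} A \<in> sets R" unfolding R_def using A by (intro sets_PiM_I_finite) auto
  have vim: "(\<lambda>x. z i + c * x) -` A i \<in> sets borel" if "i < n" for i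
    using A[of i] that by (intro measurable_sets_borel[of _ borel]) auto
  have "emeasure (density (distr R R T) (\<lambda>_. ennreal (\<bar>c\<bar> ^ n))) (Pi\<^sub>E {..<n} A)
      = ennreal (\<bar>c\<bar> ^ n) * emeasure R (T -` Pi\<^sub>E {..<n} A \<inter> space R)"
    using AR by (simp add: emeasure_density_const emeasure_distr)
  also have "T -` Pi\<^sub>E {..<n} A \<inter> space R = Pi\<^sub>E {..<n} (\<lambda>i. (\<lambda>x. z i + c * x) -` A i)"
    by (auto simp: R_def T_def space_PiM PiE_iff)
  also have "emeasure R \<dots> = (\<Prod>i<n. emeasure lborel ((\<lambda>x. z i + c * x) -` A i))"
    unfolding R_def using vim by (intro emeasure_PiM) auto
  also have "ennreal (\<bar>c\<bar> ^ n) * \<dots> = (\<Prod>i<n. ennreal \<bar>c\<bar> * emeasure lborel ((\<lambda>x. z i + c * x) -` A i))"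
    by (simp add: prod.distrib ennreal_power)
  also have "\<dots> = (\<Prod>i<n. emeasure lborel (A i))"
  proof (rule prod.cong)
    fix i assume "i \<in> {..<n}"
    then have "A i \<in> sets borel" using A by simp
    then show "ennreal \<bar>c\<bar> * emeasure lborel ((\<lambda>x. z i + c * x) -` A i) = emeasure lborel (A i)"
      by (subst (2) lborel_real_affine[OF assms(1), of "z i"])
        (simp add: emeasure_density_const emeasure_distr)
  qed simp
  finally show "emeasure (density (distr (Pi\<^sub>M {..<n} (\<lambda>i. lborel)) (Pi\<^sub>M {..<n} (\<lambda>i. lborel)) T)
      (\<lambda>_. ennreal (\<bar>c\<bar> ^ n))) (Pi\<^sub>E {..<n} A) = (\<Prod>i<n. emeasure lborel (A i))"
    by (simp add: R_def)
qed (simp_all add: R_def)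

lemma lebesgue_Rn_affine:
  assumes c: "c \<noteq> 0" and z: "z \<in> Rn n"
  shows "lebesgue_Rn n = density (distr (lebesgue_Rn n) borel (\<lambda>x. z + c *\<^sub>R x)) (\<lambda>_. ennreal (\<bar>c\<bar> ^ n))"
proof (rule measure_eqI)
  let ?R = "\<Pi>\<^sub>M i\<in>{..<n}. (lborel :: real measure)"
  let ?T = "\<lambda>f. \<lambda>i\<in>{..<n}. coord z i + c * f i"
  have T [measurable]: "?T \<in> ?R \<rightarrow>\<^sub>M ?R" by measurable
  fix A assume "A \<in> sets (lebesgue_Rn n)"
  then have A [measurable]: "A \<in> sets borel" by simp
  have rT: "rvec n (?T f) = z + c *\<^sub>R rvec n f" for f
    using z by (intro c00_eqI) (auto simp: Rn_def)
  have sub: "(\<lambda>x. z + c *\<^sub>R x) -` A \<in> sets borel" by (intro measurable_sets_borel[of _ borel]) auto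
  have "emeasure (lebesgue_Rn n) A = emeasure ?R (rvec n -` A \<inter> space ?R)"
    unfolding lebesgue_Rn_def by (subst emeasure_distr) auto
  also have "\<dots> = ennreal (\<bar>c\<bar> ^ n) * emeasure ?R (?T -` (rvec n -` A \<inter> space ?R) \<inter> space ?R)"
    by (subst PiM_lborel_affine[OF c, of n "coord z"]) (simp add: emeasure_density_const emeasure_distr)
  also have "?T -` (rvec n -` A \<inter> space ?R) \<inter> space ?R = rvec n -` ((\<lambda>x. z + c *\<^sub>R x) -` A) \<inter> space ?R"
    using measurable_space[OF T] by (auto simp only: vimage_eq rT Int_iff)
  also have "emeasure ?R \<dots> = emeasure (lebesgue_Rn n) ((\<lambda>x. z + c *\<^sub>R x) -` A)"
    unfolding lebesgue_Rn_def using sub by (subst emeasure_distr) auto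
  also have "ennreal (\<bar>c\<bar> ^ n) * \<dots>
      = emeasure (density (distr (lebesgue_Rn n) borel (\<lambda>x. z + c *\<^sub>R x)) (\<lambda>_. ennreal (\<bar>c\<bar> ^ n))) A"
    by (simp add: emeasure_density_const emeasure_distr)
  finally show "emeasure (lebesgue_Rn n) A = \<dots>" .
qed simp

lemma emeasure_lebesgue_Rn_affine:
  assumes "c \<noteq> 0" "z \<in> Rn n" "A \<in> sets borel"
  shows "emeasure (lebesgue_Rn n) A = ennreal (\<bar>c\<bar> ^ n) * emeasure (lebesgue_Rn n) ((\<lambda>x. z + c *\<^sub>R x) -` A)"
  using assms(3) by (subst lebesgue_Rn_affine[OF assms(1,2)]) (simp add: emeasure_density_const emeasure_distr)

lemma integral_lebesgue_Rn_affine: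
  fixes f :: "c00 \<Rightarrow> real"
  assumes "c \<noteq> 0" "z \<in> Rn n" "f \<in> borel_measurable borel"
  shows "(\<integral>x. f x \<partial>lebesgue_Rn n) = \<bar>c\<bar> ^ n * (\<integral>x. f (z + c *\<^sub>R x) \<partial>lebesgue_Rn n)"
  using assms(3)
  by (subst lebesgue_Rn_affine[OF assms(1,2)]) (simp add: integral_density integral_distr)

section \<open>Volumes of balls, null spheres\<close>

lemma emeasure_lebesgue_Rn_cball_finite: "emeasure (lebesgue_Rn n) (cball 0 r) < \<infinity>"
proof -
  interpret product_sigma_finite "\<lambda>i::nat. lborel :: real measure"
    by (simp add: product_sigma_finite_def sigma_finite_lborel)
  let ?R = "\<Pi>\<^sub>M i\<in>{..<n}. (lborel :: real measure)"
  have sub: "rvec n -` cball 0 r \<inter> space ?R \<subseteq> Pi\<^sub>E {..<n} (\<lambda>i. {-r..r})"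
  proof
    fix f assume f: "f \<in> rvec n -` cball 0 r \<inter> space ?R"
    have "f i \<in> {-r..r}" if "i < n" for i
      using abs_coord_le[of "rvec n f" i] that f by (simp add: abs_le_iff)
    then show "f \<in> Pi\<^sub>E {..<n} (\<lambda>i. {-r..r})" using f by (simp add: space_PiM PiE_iff)
  qed
  have "emeasure (lebesgue_Rn n) (cball 0 r) = emeasure ?R (rvec n -` cball 0 r \<inter> space ?R)"
    unfolding lebesgue_Rn_def by (subst emeasure_distr) auto
  also have "\<dots> \<le> emeasure ?R (Pi\<^sub>E {..<n} (\<lambda>i. {-r..r}))"
    using sub by (intro emeasure_mono sets_PiM_I_finite) auto
  also have "\<dots> = (\<Prod>i<n. emeasure lborel {-r..r})" by (subst emeasure_PiM) auto
  also have "\<dots> < \<infinity>" by (simp add: power_less_top_ennreal emeasure_lborel_Icc_eq)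
  finally show ?thesis .
qed

lemma emeasure_lebesgue_Rn_cball:
  assumes "0 < r"
  shows "emeasure (lebesgue_Rn n) (cball 0 r) = ennreal (r ^ n) * emeasure (lebesgue_Rn n) (cball 0 1)"
proof -
  have "(\<lambda>x. 0 + r *\<^sub>R x) -` cball 0 r = (cball 0 1 :: c00 set)" using assms by auto
  then show ?thesis
    using emeasure_lebesgue_Rn_affine[of r 0 n "cball 0 r"] assms subspace_0[OF subspace_Rn] by simp
qed

text \<open>The unit cube has measure one and lies in the ball of radius \<open>real n + 1\<close>;
  scaling passes positivity on to the unit ball. The added one keeps the radius positive for
  \<open>n = 0\<close>.\<close>

lemma emeasure_lebesgue_Rn_unit_ball_pos: "0 < emeasure (lebesgue_Rn n) (cball 0 1)"
proof -
  interpret product_sigma_finite "\<lambda>i::nat. lborel :: real measure"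
    by (simp add: product_sigma_finite_def sigma_finite_lborel)
  let ?R = "\<Pi>\<^sub>M i\<in>{..<n}. (lborel :: real measure)"
  have "norm (rvec n f) \<le> real n + 1" if "\<And>i. i < n \<Longrightarrow> f i \<in> {0..1}" for f
  proof -
    have "norm (rvec n f) \<le> (\<Sum>i<n. norm (f i *\<^sub>R unit_vec i))"
      unfolding rvec_eq_sum by (rule norm_sum)
    also have "\<dots> \<le> (\<Sum>i<n. 1)" using that by (intro sum_mono) auto
    finally show ?thesis by simp
  qed
  then have sub: "Pi\<^sub>E {..<n} (\<lambda>i. {0..1}) \<subseteq> rvec n -` cball 0 (real n + 1) \<inter> space ?R"
    by (auto simp: space_PiM PiE_iff)
  have "1 = (\<Prod>i<n. emeasure lborel {0..1::real})" by simp
  also have "\<dots> = emeasure ?R (Pi\<^sub>E {..<n} (\<lambda>i. {0..1}))" by (subst emeasure_PiM) auto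
  also have "\<dots> \<le> emeasure ?R (rvec n -` cball 0 (real n + 1) \<inter> space ?R)"
    using sub by (intro emeasure_mono measurable_sets[OF rvec_measurable]) auto
  also have "\<dots> = emeasure (lebesgue_Rn n) (cball 0 (real n + 1))"
    unfolding lebesgue_Rn_def by (subst emeasure_distr) auto
  finally show ?thesis
    by (subst (asm) emeasure_lebesgue_Rn_cball) (auto simp: zero_less_iff_neq_zero)
qed

definition ball_volume :: "nat \<Rightarrow> real"
  where "ball_volume n = measure (lebesgue_Rn n) (cball 0 1)"

lemma emeasure_unit_ball: "emeasure (lebesgue_Rn n) (cball 0 1) = ennreal (ball_volume n)"
  using emeasure_lebesgue_Rn_cball_finite[of n 1] by (simp add: ball_volume_def emeasure_eq_ennreal_measure)

lemma ball_volume_pos: "0 < ball_volume n"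
  using emeasure_lebesgue_Rn_unit_ball_pos[of n] by (simp add: emeasure_unit_ball)

lemma measure_lebesgue_Rn_cball:
  "0 < r \<Longrightarrow> measure (lebesgue_Rn n) (cball 0 r) = r ^ n * ball_volume n"
  using ball_volume_pos[of n] by (simp add: measure_def emeasure_lebesgue_Rn_cball emeasure_unit_ball flip: ennreal_mult)

lemma integrable_lebesgue_Rn_bounded:
  fixes f :: "c00 \<Rightarrow> real"
  assumes "f \<in> borel_measurable borel" "\<And>x. norm x \<le> r \<Longrightarrow> \<bar>f x\<bar> \<le> C"
    and "\<And>x. \<not> norm x \<le> r \<Longrightarrow> f x = 0"
  shows "integrable (lebesgue_Rn n) f"
proof (rule Bochner_Integration.integrable_bound)
  show "integrable (lebesgue_Rn n) (\<lambda>x. C * indicator (cball 0 r) x)"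
    using emeasure_lebesgue_Rn_cball_finite[of n r]
    by (intro integrable_mult_right integrable_real_indicator) auto
  show "AE x in lebesgue_Rn n. norm (f x) \<le> norm (C * indicator (cball 0 r) x)"
    using assms(2,3) by (auto simp: indicator_def intro!: AE_I2 order_trans[OF assms(2)])
qed (use assms(1) in auto)

text \<open>A sphere of positive radius fits into the gap between the balls of radius
  \<open>r - e\<close> and \<open>r\<close>, whose volume vanishes with \<open>e\<close>. For
  \<open>r = 0\<close> it is the origin, contained in balls of vanishing volume because
  \<open>0 < n\<close>. The null spheres are those where the cutoff below has kinks and where
  \<open>sgn\<close> leaves the sphere.\<close>

lemma AE_lebesgue_Rn_norm_neq:
  assumes n: "0 < n" and r: "0 \<le> r"
  shows "AE x in lebesgue_Rn n. norm x \<noteq> r"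
proof -
  let ?S = "{x :: c00. norm x = r}"
  have S [measurable]: "?S \<in> sets borel" by measurable
  have fin: "A \<in> fmeasurable (lebesgue_Rn n)" if "A \<subseteq> cball 0 s" "A \<in> sets borel" for A s
    using that emeasure_lebesgue_Rn_cball_finite[of n s]
    by (intro fmeasurableI2[of "cball 0 s" _ A] fmeasurableI) auto
  have Sfin: "?S \<in> fmeasurable (lebesgue_Rn n)" by (intro fin[of _ r]) auto
  have "measure (lebesgue_Rn n) ?S \<le> 0"
  proof (cases "r = 0")
    case True
    have "measure (lebesgue_Rn n) ?S \<le> e ^ n * ball_volume n" if "0 < e" for e
      using measure_mono_fmeasurable[OF _ _ fin[of "cball 0 e" e], of ?S] that True
      by (simp add: measure_lebesgue_Rn_cball)
    then have "eventually (\<lambda>e. measure (lebesgue_Rn n) ?S \<le> e ^ n * ball_volume n) (at_right 0)"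
      by (intro eventually_mono[OF eventually_at_right_less])
    moreover have "((\<lambda>e. e ^ n * ball_volume n) \<longlongrightarrow> 0 ^ n * ball_volume n) (at_right 0)"
      by (intro tendsto_intros)
    ultimately have "measure (lebesgue_Rn n) ?S \<le> 0 ^ n * ball_volume n"
      by (intro tendsto_lowerbound[where F = "at_right (0::real)"]) auto
    then show ?thesis using n by (simp add: zero_power)
  next
    case False
    then have r: "0 < r" using assms by simp
    have "measure (lebesgue_Rn n) ?S \<le> (r ^ n - (r - e) ^ n) * ball_volume n" if e: "0 < e" "e < r" for e
    proof -
      have "measure (lebesgue_Rn n) ?S + measure (lebesgue_Rn n) (cball 0 (r - e))
          = measure (lebesgue_Rn n) (?S \<union> cball 0 (r - e))"
        using e fmeasurableD2[OF Sfin] fmeasurableD2[OF fin[of "cball 0 (r - e)" "r - e"]]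
        by (subst measure_Union) auto
      also have "\<dots> \<le> measure (lebesgue_Rn n) (cball 0 r)"
        using e by (intro measure_mono_fmeasurable fin[of "cball 0 r" r]) auto
      finally show ?thesis using e r by (simp add: measure_lebesgue_Rn_cball algebra_simps)
    qed
    then have "eventually (\<lambda>e. measure (lebesgue_Rn n) ?S \<le> (r ^ n - (r - e) ^ n) * ball_volume n) (at_right 0)"
      using r by (intro eventually_at_rightI[of 0 r]) auto
    moreover have "((\<lambda>e. (r ^ n - (r - e) ^ n) * ball_volume n) \<longlongrightarrow> (r ^ n - (r - 0) ^ n) * ball_volume n) (at_right 0)"
      by (intro tendsto_intros)
    ultimately have "measure (lebesgue_Rn n) ?S \<le> (r ^ n - (r - 0) ^ n) * ball_volume n"
      by (intro tendsto_lowerbound[where F = "at_right (0::real)"]) auto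
    then show ?thesis by simp
  qed
  then have "emeasure (lebesgue_Rn n) ?S = 0"
    using fmeasurableD2[OF Sfin] measure_le_0_iff[of "lebesgue_Rn n" ?S]
    by (simp add: emeasure_eq_ennreal_measure)
  then have "?S \<in> null_sets (lebesgue_Rn n)" by (auto simp: null_sets_def)
  then show ?thesis by (rule AE_I') auto
qed

section \<open>From the ball to the sphere\<close>

lemma norm_directional_derivative:
  fixes x z :: "'a :: real_inner"
  assumes "x \<noteq> 0"
  shows "((\<lambda>t. norm (x - t *\<^sub>R z)) has_real_derivative - (sgn x \<bullet> z)) (at 0)"
proof -
  have "((\<lambda>t. x - t *\<^sub>R z) has_derivative (\<lambda>t. - (t *\<^sub>R z))) (at 0)"
    by (auto intro!: derivative_eq_intros)
  moreover have "(norm has_derivative (\<lambda>h. sgn x \<bullet> h)) (at (x - 0 *\<^sub>R z))"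
    using has_derivative_norm[OF assms] by (simp add: inner_commute)
  ultimately have "((\<lambda>t. norm (x - t *\<^sub>R z)) has_derivative (\<lambda>t. sgn x \<bullet> - (t *\<^sub>R z))) (at 0)"
    by (rule has_derivative_compose)
  then show ?thesis by (auto simp: has_field_derivative_def fun_eq_iff elim!: has_derivative_eq_rhs)
qed

text \<open>The point \<open>x\<close> divides the segment from \<open>x - z\<close> to
  \<open>x + t *\<^sub>R z\<close> in the ratio 1 to \<open>t\<close>, so a single use of convexity,
  multiplied by \<open>1 + t\<close>, suffices.\<close>

lemma convex_backward_forward_difference:
  fixes f :: "'a :: real_vector \<Rightarrow> real"
  assumes "convex_on UNIV f" "0 < t"
  shows "f x - f (x - z) \<le> (f (x + t *\<^sub>R z) - f x) / t"
proof -
  let ?s = "1 / (1 + t)"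
  have e: "(1 - ?s) *\<^sub>R (x - z) + ?s *\<^sub>R (x + t *\<^sub>R z) = x"
  proof -
    have "(1 - ?s) *\<^sub>R (x - z) + ?s *\<^sub>R (x + t *\<^sub>R z) = ((1 - ?s) + ?s) *\<^sub>R x + (?s * t - (1 - ?s)) *\<^sub>R z"
      by (simp add: algebra_simps)
    also have "?s * t - (1 - ?s) = 0" using assms(2) by (simp add: field_simps)
    finally show ?thesis by simp
  qed
  have "f x \<le> (1 - ?s) * f (x - z) + ?s * f (x + t *\<^sub>R z)"
    using convex_onD[OF assms(1), of ?s "x - z" "x + t *\<^sub>R z"] assms(2) e by simp
  then have "(1 + t) * f x \<le> (1 + t) * ((1 - ?s) * f (x - z) + ?s * f (x + t *\<^sub>R z))"
    using assms(2) by (intro mult_left_mono) auto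
  also have "\<dots> = ((1 + t) * (1 - ?s)) * f (x - z) + ((1 + t) * ?s) * f (x + t *\<^sub>R z)"
    by (simp only: distrib_left mult.assoc)
  also have "(1 + t) * (1 - ?s) = t" using assms(2) by (simp add: field_simps)
  also have "(1 + t) * ?s = 1" using assms(2) by simp
  finally show ?thesis using assms(2) by (simp add: field_simps)
qed

section \<open>A piecewise linear cutoff of the unit ball\<close>

lemma cball_borel [measurable]: "cball (x :: 'a :: metric_space) r \<in> sets borel"
  by (simp add: borel_closed)

text \<open>One on the unit ball, zero beyond radius \<open>1 + \<epsilon>\<close>, radially linear
  in between. Its slope \<open>- 1 / \<epsilon>\<close> lives on the shell only, which turns a
  boundary integral into a shell average.\<close>

definition cutoff :: "real \<Rightarrow> c00 \<Rightarrow> real"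
  where "cutoff \<epsilon> x = max 0 (min 1 ((1 + \<epsilon> - norm x) / \<epsilon>))"

lemma cutoff_measurable [measurable]: "cutoff \<epsilon> \<in> borel_measurable borel"
  unfolding cutoff_def by measurable

lemma cutoff_bounds: "0 \<le> cutoff \<epsilon> x" "cutoff \<epsilon> x \<le> 1" "\<bar>cutoff \<epsilon> x\<bar> \<le> 1"
  by (auto simp: cutoff_def)

lemma cutoff_outside: "0 < \<epsilon> \<Longrightarrow> 1 + \<epsilon> \<le> norm x \<Longrightarrow> cutoff \<epsilon> x = 0"
  using divide_nonpos_pos[of "1 + \<epsilon> - norm x" \<epsilon>] by (simp add: cutoff_def)

lemma cutoff_inside: "0 < \<epsilon> \<Longrightarrow> norm x \<le> 1 \<Longrightarrow> cutoff \<epsilon> x = 1"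
  by (simp add: cutoff_def min_def max_def field_simps)

lemma cutoff_shell: "0 < \<epsilon> \<Longrightarrow> 1 \<le> norm x \<Longrightarrow> norm x \<le> 1 + \<epsilon> \<Longrightarrow> cutoff \<epsilon> x = (1 + \<epsilon> - norm x) / \<epsilon>"
  by (simp add: cutoff_def min_def max_def field_simps)

lemma cutoff_diff_le:
  assumes "0 < \<epsilon>"
  shows "\<bar>cutoff \<epsilon> x - cutoff \<epsilon> y\<bar> \<le> norm (x - y) / \<epsilon>"
proof -
  have "\<bar>cutoff \<epsilon> x - cutoff \<epsilon> y\<bar> \<le> \<bar>(1 + \<epsilon> - norm x) / \<epsilon> - (1 + \<epsilon> - norm y) / \<epsilon>\<bar>"
    unfolding cutoff_def by linarith
  also have "\<dots> = \<bar>norm y - norm x\<bar> / \<epsilon>"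
    using assms by (simp add: diff_divide_distrib[symmetric])
  also have "\<dots> \<le> norm (x - y) / \<epsilon>"
    using assms norm_triangle_ineq3[of x y] by (intro divide_right_mono) auto
  finally show ?thesis .
qed

abbreviation shell :: "real \<Rightarrow> c00 set"
  where "shell \<epsilon> \<equiv> cball 0 (1 + \<epsilon>) - cball 0 1"

text \<open>Away from the two kinks the cutoff is locally constant or affine in the norm. The shift
  by \<open>- t *\<^sub>R z\<close> and the negative slope contribute two signs that cancel.\<close>

lemma cutoff_difference_quotient:
  assumes "0 < \<epsilon>" "norm x \<noteq> 1" "norm x \<noteq> 1 + \<epsilon>"
  shows "((\<lambda>t. (cutoff \<epsilon> (x - t *\<^sub>R z) - cutoff \<epsilon> x) / t) \<longlongrightarrow> indicator (shell \<epsilon>) x * (sgn x \<bullet> z) / \<epsilon>) (at 0)"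
proof -
  have lim: "((\<lambda>t. norm (x - t *\<^sub>R z)) \<longlongrightarrow> norm (x - 0 *\<^sub>R z)) (nhds 0)"
    by (intro tendsto_intros filterlim_ident)
  have "((\<lambda>t. cutoff \<epsilon> (x - t *\<^sub>R z)) has_real_derivative indicator (shell \<epsilon>) x * (sgn x \<bullet> z) / \<epsilon>) (at 0)"
  proof -
    consider "norm x < 1" | "1 < norm x" "norm x < 1 + \<epsilon>" | "1 + \<epsilon> < norm x" using assms by linarith
    then show ?thesis
    proof cases
      case 1
      then have "eventually (\<lambda>t. norm (x - t *\<^sub>R z) < 1) (nhds 0)"
        using order_tendstoD(2)[OF lim, of 1] by simp
      then have "eventually (\<lambda>t. cutoff \<epsilon> (x - t *\<^sub>R z) = 1) (nhds 0)"
        by eventually_elim (use assms cutoff_inside in auto)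
      then show ?thesis using 1 by (subst DERIV_cong_ev[OF refl _ refl]) auto
    next
      case 2
      then have "eventually (\<lambda>t. norm (x - t *\<^sub>R z) < 1 + \<epsilon>) (nhds 0)"
          "eventually (\<lambda>t. 1 < norm (x - t *\<^sub>R z)) (nhds 0)"
        using order_tendstoD[OF lim] by auto
      then have ev: "eventually (\<lambda>t. cutoff \<epsilon> (x - t *\<^sub>R z) = (1 + \<epsilon> - norm (x - t *\<^sub>R z)) / \<epsilon>) (nhds 0)"
        by eventually_elim (use assms cutoff_shell in auto)
      have "x \<noteq> 0" using 2 by auto
      then have "((\<lambda>t. (1 + \<epsilon> - norm (x - t *\<^sub>R z)) / \<epsilon>) has_real_derivative (0 - (- (sgn x \<bullet> z))) / \<epsilon>) (at 0)"
        by (intro DERIV_cdivide DERIV_diff DERIV_const norm_directional_derivative)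
      then show ?thesis using 2 ev by (subst DERIV_cong_ev[OF refl ev refl]) auto
    next
      case 3
      then have "eventually (\<lambda>t. 1 + \<epsilon> < norm (x - t *\<^sub>R z)) (nhds 0)"
        using order_tendstoD(1)[OF lim, of "1 + \<epsilon>"] by simp
      then have "eventually (\<lambda>t. cutoff \<epsilon> (x - t *\<^sub>R z) = 0) (nhds 0)"
        by eventually_elim (use assms cutoff_outside in auto)
      then show ?thesis using 3 by (subst DERIV_cong_ev[OF refl _ refl]) auto
    qed
  qed
  then show ?thesis by (simp add: DERIV_def)
qed

lemma lipschitz_on_abs_bound:
  fixes f :: "'a :: real_normed_vector \<Rightarrow> real"
  assumes "M-lipschitz_on UNIV f"
  shows "\<bar>f x - f y\<bar> \<le> M * norm (x - y)" "\<bar>f x\<bar> \<le> \<bar>f 0\<bar> + M * norm x"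
  using lipschitz_onD[OF assms, of x y] lipschitz_onD[OF assms, of x 0] by (auto simp: dist_norm)

lemma lipschitz_on_borel_measurable:
  fixes f :: "c00 \<Rightarrow> real"
  shows "M-lipschitz_on UNIV f \<Longrightarrow> f \<in> borel_measurable borel"
  by (intro borel_measurable_continuous_onI lipschitz_on_continuous_on)

text \<open>
  By convexity the backward difference \<open>f x - f (x - z)\<close> is at most any forward difference quotient
  \<open>(f (x + t z) - f x) / t\<close>. Translation invariance moves the shift by \<open>t z\<close> onto the cutoff, so for
  \<open>t \<rightarrow> 0\<close> only the cutoff is differentiated and \<open>f\<close> itself need not be differentiable.
\<close>

lemma cutoff_difference_le_shell:
  fixes f :: "c00 \<Rightarrow> real"
  assumes n: "0 < n" and cvx: "convex_on UNIV f" and lip: "M-lipschitz_on UNIV f"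
    and z: "z \<in> Rn n" and \<epsilon>: "0 < \<epsilon>"
  shows "(\<integral>x. cutoff \<epsilon> x * (f x - f (x - z)) \<partial>lebesgue_Rn n)
    \<le> (\<integral>x. indicator (shell \<epsilon>) x * (sgn x \<bullet> z) / \<epsilon> * f x \<partial>lebesgue_Rn n)"
proof -
  have [measurable]: "f \<in> borel_measurable borel" using lip by (rule lipschitz_on_borel_measurable)
  have M: "0 \<le> M" using lip by (rule lipschitz_on_nonneg)
  note fb = lipschitz_on_abs_bound[OF lip]
  \<comment> \<open>Shifted by at most \<open>norm z\<close>, the cutoff still vanishes beyond
    radius \<open>R\<close>; where it does not vanish, \<open>f\<close> is evaluated within radius
    \<open>R + norm z\<close>, and there \<open>C\<close> bounds it.\<close>
  define R where "R = 1 + \<epsilon> + norm z"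
  define C where "C = \<bar>f 0\<bar> + M * (R + norm z)"
  have R: "0 \<le> R" "1 + \<epsilon> \<le> R" using \<epsilon> by (auto simp: R_def)
  have C: "0 \<le> C" using M R(1) by (simp add: C_def)
  have fC: "\<bar>f y\<bar> \<le> C" if "norm y \<le> R + norm z" for y
    using fb(2)[of y] mult_left_mono[OF that M] by (simp add: C_def)
  define s where "s t x = (cutoff \<epsilon> (x - t *\<^sub>R z) - cutoff \<epsilon> x) / t" for t x
  have s_meas: "s t \<in> borel_measurable borel" for t unfolding s_def by measurable
  have main: "(\<integral>x. cutoff \<epsilon> x * (f x - f (x - z)) \<partial>lebesgue_Rn n) \<le> (\<integral>x. s t x * f x \<partial>lebesgue_Rn n)"
    if t: "0 < t" "t \<le> 1" for t
  proof -
    have tz: "norm (t *\<^sub>R z) \<le> norm z" using t by (simp add: mult_left_le_one_le)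
    have out: "cutoff \<epsilon> x = 0" "cutoff \<epsilon> (x - t *\<^sub>R z) = 0" if "\<not> norm x \<le> R" for x
    proof -
      have "1 + \<epsilon> \<le> norm x" "1 + \<epsilon> \<le> norm (x - t *\<^sub>R z)"
        using that tz norm_triangle_ineq2[of x "t *\<^sub>R z"] norm_ge_zero[of z] unfolding R_def by linarith+
      then show "cutoff \<epsilon> x = 0" "cutoff \<epsilon> (x - t *\<^sub>R z) = 0" using \<epsilon> cutoff_outside by auto
    qed
    have prod_le: "\<bar>a * b\<bar> \<le> C" if "\<bar>a\<bar> \<le> 1" "\<bar>b\<bar> \<le> C" for a b :: real
      using mult_mono[OF that] by (simp add: abs_mult)
    have shift: "norm (x + y) \<le> R + norm z" "norm (x - y) \<le> R + norm z" if "norm x \<le> R" "norm y \<le> norm z" for x y :: c00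
      using that norm_triangle_ineq[of x y] norm_triangle_ineq4[of x y] by auto
    have int: "integrable (lebesgue_Rn n) (\<lambda>x. cutoff \<epsilon> x * f x)"
        "integrable (lebesgue_Rn n) (\<lambda>x. cutoff \<epsilon> x * f (x - z))"
        "integrable (lebesgue_Rn n) (\<lambda>x. cutoff \<epsilon> x * f (x + t *\<^sub>R z))"
        "integrable (lebesgue_Rn n) (\<lambda>x. cutoff \<epsilon> (x - t *\<^sub>R z) * f x)"
      using out tz shift by (auto intro!: integrable_lebesgue_Rn_bounded[of _ R C] prod_le cutoff_bounds fC)
        (use order_trans in force)+
    have tr: "(\<integral>x. cutoff \<epsilon> (x - t *\<^sub>R z) * f x \<partial>lebesgue_Rn n) = (\<integral>x. cutoff \<epsilon> x * f (x + t *\<^sub>R z) \<partial>lebesgue_Rn n)"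
      by (subst integral_lebesgue_Rn_affine[of 1 "t *\<^sub>R z"])
        (use z subspace_scale[OF subspace_Rn] in \<open>auto simp: add.commute\<close>)
    have "(\<integral>x. cutoff \<epsilon> x * (f x - f (x - z)) \<partial>lebesgue_Rn n)
        \<le> (\<integral>x. (cutoff \<epsilon> x * f (x + t *\<^sub>R z) - cutoff \<epsilon> x * f x) / t \<partial>lebesgue_Rn n)"
    proof (rule integral_mono)
      fix x
      have "cutoff \<epsilon> x * (f x - f (x - z)) \<le> cutoff \<epsilon> x * ((f (x + t *\<^sub>R z) - f x) / t)"
        using t by (intro mult_left_mono convex_backward_forward_difference cvx cutoff_bounds)
      then show "cutoff \<epsilon> x * (f x - f (x - z)) \<le> (cutoff \<epsilon> x * f (x + t *\<^sub>R z) - cutoff \<epsilon> x * f x) / t"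
        by (simp add: algebra_simps)
    qed (use int in \<open>auto simp: algebra_simps\<close>)
    also have "\<dots> = (\<integral>x. s t x * f x \<partial>lebesgue_Rn n)"
      using int tr by (simp add: s_def algebra_simps)
    finally show ?thesis .
  qed
  have "(\<lambda>m. \<integral>x. s (inverse (real (Suc m))) x * f x \<partial>lebesgue_Rn n)
      \<longlonglongrightarrow> (\<integral>x. indicator (shell \<epsilon>) x * (sgn x \<bullet> z) / \<epsilon> * f x \<partial>lebesgue_Rn n)"
  \<comment> \<open>The cutoff is Lipschitz with constant \<open>1 / \<epsilon>\<close>, so its
    difference quotients are at most \<open>norm z / \<epsilon>\<close> uniformly in
    \<open>t\<close>; multiplying by the bound \<open>C\<close> on \<open>f\<close> gives the
    dominating function.\<close>
  proof (rule integral_dominated_convergence[where w = "\<lambda>x. indicator (cball 0 R) x * (norm z / \<epsilon> * C)"])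
    show "integrable (lebesgue_Rn n) (\<lambda>x. indicator (cball 0 R) x * (norm z / \<epsilon> * C))"
    proof (rule integrable_lebesgue_Rn_bounded[of _ R "norm z / \<epsilon> * C"])
      show "(\<lambda>x. indicator (cball 0 R) x * (norm z / \<epsilon> * C)) \<in> borel_measurable borel" by measurable
    qed (use \<epsilon> C in auto)
    have "AE x in lebesgue_Rn n. norm x \<noteq> 1" "AE x in lebesgue_Rn n. norm x \<noteq> 1 + \<epsilon>"
      using n \<epsilon> by (auto intro!: AE_lebesgue_Rn_norm_neq)
    then show "AE x in lebesgue_Rn n. (\<lambda>m. s (inverse (real (Suc m))) x * f x)
        \<longlonglongrightarrow> indicator (shell \<epsilon>) x * (sgn x \<bullet> z) / \<epsilon> * f x"
    proof eventually_elim
      case (elim x)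
      have "filterlim (\<lambda>m. inverse (real (Suc m))) (at 0) sequentially"
        unfolding filterlim_at using LIMSEQ_inverse_real_of_nat by auto
      from filterlim_compose[OF cutoff_difference_quotient[OF \<epsilon> elim, of z] this]
      show ?case unfolding s_def by (intro tendsto_mult tendsto_const)
    qed
    show "AE x in lebesgue_Rn n. norm (s (inverse (real (Suc m))) x * f x) \<le> indicator (cball 0 R) x * (norm z / \<epsilon> * C)" for m
    proof (rule AE_I2)
      fix x
      define t where "t = inverse (real (Suc m))"
      have t: "0 < t" "t \<le> 1" by (auto simp: t_def field_simps)
      show "norm (s (inverse (real (Suc m))) x * f x) \<le> indicator (cball 0 R) x * (norm z / \<epsilon> * C)"
        unfolding t_def[symmetric]
      proof (cases "norm x \<le> R")
        case True
        have "\<bar>cutoff \<epsilon> (x - t *\<^sub>R z) - cutoff \<epsilon> x\<bar> \<le> t * norm z / \<epsilon>"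
          using cutoff_diff_le[OF \<epsilon>, of "x - t *\<^sub>R z" x] t by simp
        then have "\<bar>s t x\<bar> \<le> norm z / \<epsilon>" using t \<epsilon> by (simp add: s_def abs_divide field_simps)
        moreover have "\<bar>f x\<bar> \<le> C" using True by (intro fC) (simp add: add_increasing2)
        ultimately have "\<bar>s t x\<bar> * \<bar>f x\<bar> \<le> norm z / \<epsilon> * C" using \<epsilon> by (intro mult_mono) auto
        then show "norm (s t x * f x) \<le> indicator (cball 0 R) x * (norm z / \<epsilon> * C)"
          using True by (simp add: abs_mult)
      next
        case False
        have tz: "norm (t *\<^sub>R z) \<le> norm z" using t by (simp add: mult_left_le_one_le)
        have "1 + \<epsilon> \<le> norm x" "1 + \<epsilon> \<le> norm (x - t *\<^sub>R z)"
          using False tz norm_triangle_ineq2[of x "t *\<^sub>R z"] norm_ge_zero[of z] unfolding R_def by linarith+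
        then have "cutoff \<epsilon> x = 0" "cutoff \<epsilon> (x - t *\<^sub>R z) = 0" using \<epsilon> cutoff_outside by auto
        then show "norm (s t x * f x) \<le> indicator (cball 0 R) x * (norm z / \<epsilon> * C)"
          using \<epsilon> C by (simp add: s_def)
      qed
    qed
  qed (use s_meas in \<open>auto simp: sgn_div_norm\<close>)
  then show ?thesis
  proof (rule tendsto_lowerbound)
    show "\<forall>\<^sub>F m in sequentially. (\<integral>x. cutoff \<epsilon> x * (f x - f (x - z)) \<partial>lebesgue_Rn n)
        \<le> (\<integral>x. s (inverse (real (Suc m))) x * f x \<partial>lebesgue_Rn n)"
      by (intro always_eventually allI main) (auto simp: field_simps)
  qed simp
qed

text \<open>
  The shell has relative volume \<open>(1 + \<epsilon>) ^ n - 1\<close>, so its average over the width \<open>\<epsilon>\<close> tends to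
  \<open>n\<close> times the radially projected integral over the ball. This replaces the divergence theorem.
\<close>

lemma sphere_smoothing_lebesgue:
  fixes f :: "c00 \<Rightarrow> real"
  assumes n: "0 < n" and cvx: "convex_on UNIV f" and lip: "M-lipschitz_on UNIV f" and z: "z \<in> Rn n"
  shows "(\<integral>x. indicator (cball 0 1) x * (f x - f (x - z)) \<partial>lebesgue_Rn n)
    \<le> real n * (\<integral>x. indicator (cball 0 1) x * (f (sgn x) * (sgn x \<bullet> z)) \<partial>lebesgue_Rn n)"
    (is "?J \<le> real n * ?I")
proof -
  have f [measurable]: "f \<in> borel_measurable borel" using lip by (rule lipschitz_on_borel_measurable)
  have M: "0 \<le> M" using lip by (rule lipschitz_on_nonneg)
  note fb = lipschitz_on_abs_bound[OF lip]
  \<comment> \<open>\<open>g\<close> depends on the direction only, so its integral over a ball of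
    radius \<open>r\<close> is \<open>r ^ n\<close> times the one over the unit ball.\<close>
  define g where "g x = f (sgn x) * (sgn x \<bullet> z)" for x
  have g [measurable]: "g \<in> borel_measurable borel" unfolding g_def sgn_div_norm by measurable
  define C where "C = (\<bar>f 0\<bar> + M) * norm z"
  have sgn1: "norm (sgn x) \<le> 1" for x :: c00 by (simp add: norm_sgn)
  have sz: "\<bar>sgn x \<bullet> z\<bar> \<le> norm z" for x
    using Cauchy_Schwarz_ineq2[of "sgn x" z] mult_right_mono[OF sgn1, of "norm z" x] by simp
  have gC: "\<bar>g x\<bar> \<le> C" for x
    unfolding g_def C_def abs_mult
    using fb(2)[of "sgn x"] mult_left_mono[OF sgn1[of x] M] by (intro mult_mono sz) auto
  have dz: "\<bar>f x - f (x - z)\<bar> \<le> M * norm z" for x using fb(1)[of x "x - z"] by simp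
  let ?L = "lebesgue_Rn n" and ?\<kappa> = "ball_volume n"
  have ind: "integrable ?L (\<lambda>x. indicator (cball 0 r) x * h x)" "integrable ?L (\<lambda>x. indicator (cball 0 r - cball 0 1) x * h x)"
    if "h \<in> borel_measurable borel" "\<And>x. \<bar>h x\<bar> \<le> B" for h :: "c00 \<Rightarrow> real" and r B
  proof -
    have "0 \<le> B" using that(2)[of 0] by linarith
    then show "integrable ?L (\<lambda>x. indicator (cball 0 r) x * h x)" "integrable ?L (\<lambda>x. indicator (cball 0 r - cball 0 1) x * h x)"
      using that by (auto intro!: integrable_lebesgue_Rn_bounded[of _ r B] simp: indicator_def)
  qed
  \<comment> \<open>Two replacements are made on the shell: the cutoff by zero, and
    \<open>f x\<close> by \<open>f (sgn x)\<close>. Each costs at most \<open>M * norm z\<close>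
    times the shell volume, hence the factor 2; in the second, the distance
    \<open>\<epsilon>\<close> to the sphere offsets the factor
    \<open>1 / \<epsilon>\<close>.\<close>
  have key: "?J \<le> ((1 + \<epsilon>) ^ n - 1) / \<epsilon> * ?I + 2 * (M * norm z) * (((1 + \<epsilon>) ^ n - 1) * ?\<kappa>)" if \<epsilon>: "0 < \<epsilon>" for \<epsilon>
  proof -
    let ?c = "cball 0 (1 + \<epsilon>) :: c00 set" and ?b = "cball 0 1 :: c00 set"
    have sh: "indicator (shell \<epsilon>) x = (indicator ?c x - indicator ?b x :: real)" for x
      using \<epsilon> by (auto simp: indicator_def)
    have vol: "(\<integral>x. indicator (shell \<epsilon>) x * a \<partial>?L) = a * (((1 + \<epsilon>) ^ n - 1) * ?\<kappa>)" for a
    proof -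
      have "(\<integral>x. indicator (shell \<epsilon>) x * a \<partial>?L) = (\<integral>x. indicator ?c x * a - indicator ?b x * a \<partial>?L)"
        by (simp add: sh algebra_simps)
      also have "\<dots> = (\<integral>x. indicator ?c x * a \<partial>?L) - (\<integral>x. indicator ?b x * a \<partial>?L)"
        by (intro Bochner_Integration.integral_diff ind[of _ "\<bar>a\<bar>"]) auto
      also have "\<dots> = a * (((1 + \<epsilon>) ^ n - 1) * ?\<kappa>)"
        using \<epsilon> by (simp add: measure_lebesgue_Rn_cball algebra_simps)
      finally show ?thesis .
    qed
    have scale: "(\<integral>x. indicator ?c x * g x \<partial>?L) = (1 + \<epsilon>) ^ n * ?I"
    proof -
      have "(\<integral>x. indicator ?c x * g x \<partial>?L)
          = \<bar>1 + \<epsilon>\<bar> ^ n * (\<integral>x. indicator ?c (0 + (1 + \<epsilon>) *\<^sub>R x) * g (0 + (1 + \<epsilon>) *\<^sub>R x) \<partial>?L)"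
        using \<epsilon> subspace_0[OF subspace_Rn] by (intro integral_lebesgue_Rn_affine) auto
      also have "(\<lambda>x. indicator ?c (0 + (1 + \<epsilon>) *\<^sub>R x) * g (0 + (1 + \<epsilon>) *\<^sub>R x)) = (\<lambda>x. indicator ?b x * g x)"
        using \<epsilon> by (auto simp: fun_eq_iff g_def sgn_scaleR indicator_def)
      finally show ?thesis using \<epsilon> by (simp add: g_def)
    qed
    have int_f: "integrable ?L (\<lambda>x. indicator ?b x * (f x - f (x - z)))"
      using dz by (intro ind(1)) auto
    have int_shell: "integrable ?L (\<lambda>x. indicator (shell \<epsilon>) x * a)" for a :: real
      by (intro ind(2)[of _ "\<bar>a\<bar>"]) auto
    have "?J - M * norm z * (((1 + \<epsilon>) ^ n - 1) * ?\<kappa>)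
        = (\<integral>x. indicator ?b x * (f x - f (x - z)) - indicator (shell \<epsilon>) x * (M * norm z) \<partial>?L)"
      using int_f int_shell by (simp only: Bochner_Integration.integral_diff vol)
    also have "\<dots> \<le> (\<integral>x. cutoff \<epsilon> x * (f x - f (x - z)) \<partial>?L)"
    proof (rule integral_mono)
      fix x
      show "indicator ?b x * (f x - f (x - z)) - indicator (shell \<epsilon>) x * (M * norm z) \<le> cutoff \<epsilon> x * (f x - f (x - z))"
      proof (cases "x \<in> shell \<epsilon>")
        case True
        have "\<bar>cutoff \<epsilon> x * (f x - f (x - z))\<bar> \<le> 1 * (M * norm z)"
          unfolding abs_mult by (intro mult_mono cutoff_bounds dz) auto
        then show ?thesis using True by simp
      next
        case False
        then show ?thesis using cutoff_inside[OF \<epsilon>, of x] cutoff_outside[OF \<epsilon>, of x] by (auto simp: indicator_def)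
      qed
    next
      show "integrable ?L (\<lambda>x. cutoff \<epsilon> x * (f x - f (x - z)))"
      proof (rule integrable_lebesgue_Rn_bounded[of _ "1 + \<epsilon>" "1 * (M * norm z)"])
        show "\<bar>cutoff \<epsilon> x * (f x - f (x - z))\<bar> \<le> 1 * (M * norm z)" for x
          unfolding abs_mult by (intro mult_mono cutoff_bounds dz) auto
      qed (use cutoff_outside[OF \<epsilon>] in auto)
    qed (intro Bochner_Integration.integrable_diff int_f int_shell)
    also have "\<dots> \<le> (\<integral>x. indicator (shell \<epsilon>) x * (sgn x \<bullet> z) / \<epsilon> * f x \<partial>?L)"
      by (rule cutoff_difference_le_shell[OF n cvx lip z \<epsilon>])
    also have "\<dots> \<le> (\<integral>x. (indicator ?c x * g x - indicator ?b x * g x) / \<epsilon> + indicator (shell \<epsilon>) x * (M * norm z) \<partial>?L)"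
    proof (rule integral_mono)
      show "integrable ?L (\<lambda>x. indicator (shell \<epsilon>) x * (sgn x \<bullet> z) / \<epsilon> * f x)"
      proof (rule integrable_lebesgue_Rn_bounded[of _ "1 + \<epsilon>" "norm z / \<epsilon> * (\<bar>f 0\<bar> + M * (1 + \<epsilon>))"])
        fix x :: c00 assume x: "norm x \<le> 1 + \<epsilon>"
        have "\<bar>f x\<bar> \<le> \<bar>f 0\<bar> + M * (1 + \<epsilon>)" using fb(2)[of x] mult_left_mono[OF x M] by simp
        then show "\<bar>indicator (shell \<epsilon>) x * (sgn x \<bullet> z) / \<epsilon> * f x\<bar> \<le> norm z / \<epsilon> * (\<bar>f 0\<bar> + M * (1 + \<epsilon>))"
          unfolding abs_mult abs_divide using sz[of x] \<epsilon> M
          by (intro mult_mono) (auto simp: indicator_def divide_right_mono)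
      qed (auto simp: sgn_div_norm)
      show "integrable ?L (\<lambda>x. (indicator ?c x * g x - indicator ?b x * g x) / \<epsilon> + indicator (shell \<epsilon>) x * (M * norm z))"
        using ind[OF g gC] ind[of "\<lambda>_. M * norm z" "M * norm z"] M by auto
      fix x
      show "indicator (shell \<epsilon>) x * (sgn x \<bullet> z) / \<epsilon> * f x
          \<le> (indicator ?c x * g x - indicator ?b x * g x) / \<epsilon> + indicator (shell \<epsilon>) x * (M * norm z)"
      proof (cases "x \<in> shell \<epsilon>")
        case True
        then have x: "1 < norm x" "norm x \<le> 1 + \<epsilon>" by auto
        have "x \<noteq> 0" using x by auto
        then have "norm x *\<^sub>R sgn x = x" by (simp add: sgn_div_norm)
        then have "x - sgn x = (norm x - 1) *\<^sub>R sgn x" by (simp add: scaleR_left_diff_distrib)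
        then have "norm (x - sgn x) \<le> \<epsilon>" using x by (auto simp: norm_sgn)
        then have "\<bar>f x - f (sgn x)\<bar> \<le> M * \<epsilon>" using fb(1)[of x "sgn x"] M by (meson mult_left_mono order_trans)
        then have "\<bar>(sgn x \<bullet> z) * (f x - f (sgn x))\<bar> \<le> norm z * (M * \<epsilon>)"
          unfolding abs_mult by (intro mult_mono sz) auto
        then have "(sgn x \<bullet> z) * f x \<le> g x + norm z * (M * \<epsilon>)" by (simp add: g_def algebra_simps abs_le_iff)
        then show ?thesis using True x \<epsilon> by (simp add: sh[symmetric] field_simps)
      next
        case False
        then show ?thesis using \<epsilon> by (auto simp: indicator_def)
      qed
    qed
    also have "\<dots> = ((1 + \<epsilon>) ^ n - 1) / \<epsilon> * ?I + M * norm z * (((1 + \<epsilon>) ^ n - 1) * ?\<kappa>)"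
    proof -
      have "(\<integral>x. (indicator ?c x * g x - indicator ?b x * g x) / \<epsilon> + indicator (shell \<epsilon>) x * (M * norm z) \<partial>?L)
          = ((\<integral>x. indicator ?c x * g x \<partial>?L) - (\<integral>x. indicator ?b x * g x \<partial>?L)) / \<epsilon>
            + (\<integral>x. indicator (shell \<epsilon>) x * (M * norm z) \<partial>?L)"
        using ind[OF g gC] ind[of "\<lambda>_. M * norm z" "M * norm z"] M by simp
      then show ?thesis unfolding scale vol by (simp add: g_def algebra_simps diff_divide_distrib)
    qed
    finally show ?thesis by (simp add: algebra_simps)
  qed
  \<comment> \<open>The dimension factor is the derivative of \<open>r ^ n\<close> at
    \<open>r = 1\<close>.\<close>
  have d: "((\<lambda>\<epsilon>::real. ((1 + \<epsilon>) ^ n - 1) / \<epsilon>) \<longlongrightarrow> real n) (at_right 0)"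
  proof -
    have "((\<lambda>x::real. x ^ n) has_real_derivative real n * 1 ^ (n - Suc 0)) (at 1)" by (rule DERIV_pow)
    then have "((\<lambda>\<epsilon>::real. ((1 + \<epsilon>) ^ n - 1) / \<epsilon>) \<longlongrightarrow> real n) (at 0)" by (simp add: DERIV_def)
    then show ?thesis by (rule tendsto_mono[rotated]) (simp add: at_le)
  qed
  have "((\<lambda>\<epsilon>. ((1 + \<epsilon>) ^ n - 1) / \<epsilon> * ?I + 2 * (M * norm z) * (((1 + \<epsilon>) ^ n - 1) * ?\<kappa>))
      \<longlongrightarrow> real n * ?I + 2 * (M * norm z) * (((1 + 0) ^ n - 1) * ?\<kappa>)) (at_right 0)"
    by (intro tendsto_intros d)
  then have "?J \<le> real n * ?I + 2 * (M * norm z) * (((1 + 0) ^ n - 1) * ?\<kappa>)"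
    by (rule tendsto_lowerbound) (rule eventually_mono[OF eventually_at_right_less], erule key, simp)
  then show ?thesis by simp
qed

section \<open>Uniform distributions on the ball and the sphere\<close>

definition uniform_ball :: "nat \<Rightarrow> c00 measure"
  where "uniform_ball n = uniform_measure (lebesgue_Rn n) (cball 0 1)"

lemma sets_uniform_ball [measurable_cong, simp]: "sets (uniform_ball n) = sets borel"
  by (simp add: uniform_ball_def)

lemma space_uniform_ball [simp]: "space (uniform_ball n) = UNIV"
  by (simp add: uniform_ball_def)

lemma prob_space_uniform_ball: "prob_space (uniform_ball n)"
  unfolding uniform_ball_def using emeasure_lebesgue_Rn_unit_ball_pos[of n] emeasure_lebesgue_Rn_cball_finite[of n 1]
  by (intro prob_space_uniform_measure) auto

lemma integral_uniform_ball:
  fixes f :: "c00 \<Rightarrow> real"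
  assumes [measurable]: "f \<in> borel_measurable borel"
  shows "(\<integral>x. f x \<partial>uniform_ball n) = (\<integral>x. indicator (cball 0 1) x * f x \<partial>lebesgue_Rn n) / ball_volume n"
proof -
  have "uniform_ball n = density (lebesgue_Rn n) (\<lambda>x. ennreal (indicator (cball 0 1) x / ball_volume n))"
    unfolding uniform_ball_def uniform_measure_def emeasure_unit_ball using ball_volume_pos[of n]
    by (intro arg_cong[where f = "density _"]) (auto simp: fun_eq_iff indicator_def ennreal_1[symmetric] divide_ennreal simp del: ennreal_1)
  then have "(\<integral>x. f x \<partial>uniform_ball n)
      = (\<integral>x. (indicator (cball 0 1) x / ball_volume n) *\<^sub>R f x \<partial>lebesgue_Rn n)"
    using ball_volume_pos[of n] by (simp add: integral_density)
  then show ?thesis by simp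
qed

lemma AE_uniform_ballI:
  "AE x in lebesgue_Rn n. norm x \<le> 1 \<longrightarrow> P x \<Longrightarrow> AE x in uniform_ball n. P x"
  unfolding uniform_ball_def by (rule AE_uniform_measureI) auto

lemma AE_uniform_ball: "AE x in uniform_ball n. x \<in> Rn n \<and> norm x \<le> 1"
  using AE_lebesgue_Rn[of n] by (intro AE_uniform_ballI) auto

text \<open>Reflection is the affine change of variables with factor -1 and preserves the measure.
  It removes the first-order terms in the gradient estimate.\<close>

lemma integral_uniform_ball_odd:
  fixes f :: "c00 \<Rightarrow> real"
  assumes [measurable]: "f \<in> borel_measurable borel" and "\<And>x. f (- x) = - f x"
  shows "(\<integral>x. f x \<partial>uniform_ball n) = 0"
proof -
  let ?g = "\<lambda>x. indicator (cball 0 1) x * f x"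
  have "(\<integral>x. ?g x \<partial>lebesgue_Rn n) = \<bar>-1\<bar> ^ n * (\<integral>x. ?g (0 + (-1) *\<^sub>R x) \<partial>lebesgue_Rn n)"
    using subspace_0[OF subspace_Rn] by (intro integral_lebesgue_Rn_affine) auto
  also have "(\<lambda>x. ?g (0 + (-1) *\<^sub>R x)) = (\<lambda>x. - ?g x)"
    using assms(2) by (auto simp: fun_eq_iff indicator_def)
  finally show ?thesis by (simp add: integral_uniform_ball)
qed

lemma sgn_borel_measurable [measurable]: "(sgn :: c00 \<Rightarrow> c00) \<in> borel_measurable borel"
  unfolding sgn_div_norm[abs_def] by measurable

lemma closed_unit_sphere: "closed (unit_sphere n)"
proof -
  have "unit_sphere n = Rn n \<inter> sphere 0 1" by (auto simp: unit_sphere_def)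
  moreover have "closed (sphere (0 :: c00) 1)"
    unfolding sphere_def by (intro closed_Collect_eq continuous_intros)
  ultimately show ?thesis using closed_Rn by (simp add: closed_Int)
qed

lemma unit_sphere_borel [measurable]: "unit_sphere n \<in> sets borel"
  using closed_unit_sphere by (rule borel_closed)

lemma uniform_sphere_eq:
  "uniform_sphere n = restrict_space (distr (uniform_ball n) borel sgn) (unit_sphere n)"
proof -
  let ?R = "\<Pi>\<^sub>M i\<in>{..<n}. (lborel :: real measure)"
  let ?A = "{a \<in> space ?R. norm (rvec n a) \<le> 1}"
  have A [measurable]: "?A \<in> sets ?R" by measurable
  have "uniform_ball n = distr (uniform_measure ?R ?A) borel (rvec n)"
  proof (rule measure_eqI)
    fix X assume "X \<in> sets (uniform_ball n)"
    then have [measurable]: "X \<in> sets borel" by simp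
    have "rvec n -` (cball 0 1 \<inter> X) \<inter> space ?R = ?A \<inter> (rvec n -` X \<inter> space ?R)"
        "rvec n -` cball 0 1 \<inter> space ?R = ?A"
      by auto
    then show "emeasure (uniform_ball n) X = emeasure (distr (uniform_measure ?R ?A) borel (rvec n)) X"
      by (simp add: uniform_ball_def lebesgue_Rn_def emeasure_distr)
  qed simp
  then have "distr (uniform_ball n) borel sgn = distr (uniform_measure ?R ?A) borel (\<lambda>a. sgn (rvec n a))"
    by (simp add: distr_distr comp_def)
  then show ?thesis by (simp add: uniform_sphere_def Let_def)
qed

lemma space_uniform_sphere [simp]: "space (uniform_sphere n) = unit_sphere n"
  by (simp add: uniform_sphere_eq space_restrict_space)

lemma uniform_sphere_measurable_borel: "id \<in> uniform_sphere n \<rightarrow>\<^sub>M borel"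
  unfolding uniform_sphere_eq by (intro measurable_restrict_space1) simp

text \<open>Within \<open>Rn n\<close> only the origin fails, as \<open>sgn 0 = 0\<close>; it is
  null in positive dimension. Hence cutting the measure down to the sphere loses no mass.\<close>

lemma AE_uniform_ball_sgn:
  assumes "0 < n"
  shows "AE x in uniform_ball n. sgn x \<in> unit_sphere n"
proof (rule AE_uniform_ballI)
  have "AE x in lebesgue_Rn n. norm x \<noteq> 0" "AE x in lebesgue_Rn n. x \<in> Rn n"
    by (rule AE_lebesgue_Rn_norm_neq[OF assms order_refl], rule AE_lebesgue_Rn)
  then show "AE x in lebesgue_Rn n. norm x \<le> 1 \<longrightarrow> sgn x \<in> unit_sphere n"
    by eventually_elim (auto simp: unit_sphere_def sgn_div_norm intro!: subspace_scale subspace_Rn)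
qed

lemma prob_space_uniform_sphere:
  assumes "0 < n"
  shows "prob_space (uniform_sphere n)"
  unfolding uniform_sphere_eq
proof (rule prob_space_restrict_space)
  interpret U: prob_space "uniform_ball n" by (rule prob_space_uniform_ball)
  interpret prob_space "distr (uniform_ball n) borel sgn" by (rule U.prob_space_distr) simp
  have "AE x in distr (uniform_ball n) borel sgn. x \<in> unit_sphere n"
    using AE_uniform_ball_sgn[OF assms] by (subst AE_distr_iff) auto
  then show "emeasure (distr (uniform_ball n) borel sgn) (unit_sphere n) = 1"
    by (intro emeasure_eq_1_AE) auto
qed auto

lemma integral_uniform_sphere:
  fixes f :: "c00 \<Rightarrow> real"
  assumes "0 < n" and [measurable]: "f \<in> borel_measurable borel"
  shows "(\<integral>v. f v \<partial>uniform_sphere n) = (\<integral>x. f (sgn x) \<partial>uniform_ball n)"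
proof -
  have "(\<integral>v. f v \<partial>uniform_sphere n) = (\<integral>x. indicator (unit_sphere n) (sgn x) *\<^sub>R f (sgn x) \<partial>uniform_ball n)"
    unfolding uniform_sphere_eq by (subst integral_restrict_space) (simp_all add: integral_distr)
  also have "\<dots> = (\<integral>x. f (sgn x) \<partial>uniform_ball n)"
    using AE_uniform_ball_sgn[OF assms(1)] by (intro integral_cong_AE) auto
  finally show ?thesis .
qed

lemma sphere_smoothing:
  fixes f :: "c00 \<Rightarrow> real"
  assumes "0 < n" "convex_on UNIV f" and lip: "M-lipschitz_on UNIV f" and "z \<in> Rn n"
  shows "(\<integral>x. f x - f (x - z) \<partial>uniform_ball n) \<le> real n * (\<integral>v. f v * (v \<bullet> z) \<partial>uniform_sphere n)"
proof -
  have [measurable]: "f \<in> borel_measurable borel" using lip by (rule lipschitz_on_borel_measurable)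
  have "(\<integral>v. f v * (v \<bullet> z) \<partial>uniform_sphere n)
      = (\<integral>x. indicator (cball 0 1) x * (f (sgn x) * (sgn x \<bullet> z)) \<partial>lebesgue_Rn n) / ball_volume n"
    using assms(1) by (simp add: integral_uniform_sphere integral_uniform_ball)
  then show ?thesis
    using divide_right_mono[OF sphere_smoothing_lebesgue[OF assms], of "ball_volume n"] ball_volume_pos[of n]
    by (simp add: integral_uniform_ball)
qed

text \<open>
  The bias is of order \<open>\<delta>\<^sup>2\<close> with a constant free of the dimension: averaging over the ball costs
  \<open>L \<delta>\<^sup>2\<close> at \<open>u\<close> by smoothness and nothing at \<open>w\<close> by convexity. A Taylor expansion of \<open>f\<close> on the
  sphere would only give order \<open>\<delta>\<close>. The baseline \<open>c\<close> stands for the previous measurement.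
\<close>

lemma one_point_gradient_estimate:
  fixes f :: "c00 \<Rightarrow> real"
  assumes n: "0 < n" and cvx: "convex_on UNIV f" and lip: "M-lipschitz_on UNIV f"
    and w: "w \<in> Rn n" and u: "u \<in> Rn n" and \<delta>: "0 < \<delta>" and L: "0 \<le> L"
    and lower: "\<And>y. y \<in> Rn n \<Longrightarrow> f w + gw \<bullet> (y - w) \<le> f y"
    and upper: "\<And>y. y \<in> Rn n \<Longrightarrow> f y \<le> f u + gu \<bullet> (y - u) + L * (norm (y - u))\<^sup>2"
  shows "f w - f u - L * \<delta>\<^sup>2 \<le> real n / \<delta> * (\<integral>v. (f (w + \<delta> *\<^sub>R v) - c) * (v \<bullet> (w - u)) \<partial>uniform_sphere n)"
proof -
  \<comment> \<open>In \<open>F x - F (x - z)\<close> the baseline cancels, and the scaling of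
    \<open>z\<close> makes the shift carry \<open>w + \<delta> *\<^sub>R x\<close> to
    \<open>u + \<delta> *\<^sub>R x\<close>: the same perturbation is applied at both
    points.\<close>
  define F where "F x = f (w + \<delta> *\<^sub>R x) - c" for x
  define z where "z = (1 / \<delta>) *\<^sub>R (w - u)"
  have z: "z \<in> Rn n" unfolding z_def using w u by (intro subspace_scale subspace_diff subspace_Rn)
  have F_cvx: "convex_on UNIV F"
  proof (rule convex_onI)
    fix t :: real and x y assume t: "0 < t" "t < 1"
    have e: "w + \<delta> *\<^sub>R ((1 - t) *\<^sub>R x + t *\<^sub>R y) = (1 - t) *\<^sub>R (w + \<delta> *\<^sub>R x) + t *\<^sub>R (w + \<delta> *\<^sub>R y)"
      by (simp add: algebra_simps)
    show "F ((1 - t) *\<^sub>R x + t *\<^sub>R y) \<le> (1 - t) * F x + t * F y"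
      unfolding F_def e using convex_onD[OF cvx, of t "w + \<delta> *\<^sub>R x" "w + \<delta> *\<^sub>R y"] t by (simp add: algebra_simps)
  qed simp
  have F_lip: "(M * \<delta>)-lipschitz_on UNIV F"
  proof (rule lipschitz_onI)
    fix x y
    have "dist (F x) (F y) \<le> M * dist (w + \<delta> *\<^sub>R x) (w + \<delta> *\<^sub>R y)"
      unfolding F_def using lipschitz_onD[OF lip, of "w + \<delta> *\<^sub>R x" "w + \<delta> *\<^sub>R y"] by (simp add: dist_norm)
    also have "dist (w + \<delta> *\<^sub>R x) (w + \<delta> *\<^sub>R y) = \<delta> * dist x y"
      using \<delta> by (simp add: dist_norm flip: scaleR_diff_right)
    finally show "dist (F x) (F y) \<le> M * \<delta> * dist x y" by simp
  qed (use \<delta> lipschitz_on_nonneg[OF lip] in simp)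
  have [measurable]: "F \<in> borel_measurable borel" using F_lip by (rule lipschitz_on_borel_measurable)
  interpret U: prob_space "uniform_ball n" by (rule prob_space_uniform_ball)
  \<comment> \<open>The linear terms of the lower bound at \<open>w\<close> and of the upper bound
    at \<open>u\<close> have mean zero over the ball, which leaves only the quadratic error.\<close>
  have lin: "(\<integral>x. a + (gw - gu) \<bullet> x * \<delta> \<partial>uniform_ball n) = a"
      "integrable (uniform_ball n) (\<lambda>x. a + (gw - gu) \<bullet> x * \<delta>)" for a
  proof -
    have i: "integrable (uniform_ball n) (\<lambda>x. (gw - gu) \<bullet> x)"
    proof (rule U.integrable_const_bound)
      show "AE x in uniform_ball n. norm ((gw - gu) \<bullet> x) \<le> norm (gw - gu)"
        using AE_uniform_ball[of n]
      proof eventually_elim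
        case (elim x)
        then show ?case
          using Cauchy_Schwarz_ineq2[of "gw - gu" x] mult_left_mono[of "norm x" 1 "norm (gw - gu)"] by simp
      qed
    qed simp
    then show "integrable (uniform_ball n) (\<lambda>x. a + (gw - gu) \<bullet> x * \<delta>)" by simp
    have "(\<integral>x. (gw - gu) \<bullet> x \<partial>uniform_ball n) = 0" by (rule integral_uniform_ball_odd) simp_all
    then show "(\<integral>x. a + (gw - gu) \<bullet> x * \<delta> \<partial>uniform_ball n) = a" using i U.prob_space by simp
  qed
  have "f w - f u - L * \<delta>\<^sup>2 = (\<integral>x. (f w - f u - L * \<delta>\<^sup>2) + (gw - gu) \<bullet> x * \<delta> \<partial>uniform_ball n)"
    by (simp only: lin)
  also have "\<dots> \<le> (\<integral>x. F x - F (x - z) \<partial>uniform_ball n)"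
  proof (rule integral_mono_AE)
    show "integrable (uniform_ball n) (\<lambda>x. F x - F (x - z))"
    proof (rule U.integrable_const_bound)
      show "AE x in uniform_ball n. norm (F x - F (x - z)) \<le> M * \<delta> * norm z"
      proof (rule AE_I2)
        show "norm (F x - F (x - z)) \<le> M * \<delta> * norm z" for x
          using lipschitz_on_abs_bound(1)[OF F_lip, of x "x - z"] by simp
      qed
    qed simp
    show "AE x in uniform_ball n. (f w - f u - L * \<delta>\<^sup>2) + (gw - gu) \<bullet> x * \<delta> \<le> F x - F (x - z)"
      using AE_uniform_ball[of n]
    proof eventually_elim
      case (elim x)
      then have x: "x \<in> Rn n" "norm x \<le> 1" by auto
      have wx: "w + \<delta> *\<^sub>R x \<in> Rn n" and ux: "u + \<delta> *\<^sub>R x \<in> Rn n"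
        using w u x by (auto intro!: subspace_add subspace_scale subspace_Rn)
      have "w + \<delta> *\<^sub>R (x - z) = u + \<delta> *\<^sub>R x" using \<delta> by (simp add: z_def algebra_simps)
      then have e: "F x - F (x - z) = f (w + \<delta> *\<^sub>R x) - f (u + \<delta> *\<^sub>R x)" by (simp add: F_def)
      have "L * (norm (\<delta> *\<^sub>R x))\<^sup>2 \<le> L * \<delta>\<^sup>2"
        using x \<delta> L by (intro mult_left_mono power_mono) (auto simp: mult_left_le)
      then show ?case
        using lower[OF wx] upper[OF ux] unfolding e by (simp add: algebra_simps inner_diff_left)
    qed
  qed (rule lin)
  also have "\<dots> \<le> real n * (\<integral>v. F v * (v \<bullet> z) \<partial>uniform_sphere n)"
    using n F_cvx F_lip z by (rule sphere_smoothing)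
  also have "\<dots> = real n / \<delta> * (\<integral>v. (f (w + \<delta> *\<^sub>R v) - c) * (v \<bullet> (w - u)) \<partial>uniform_sphere n)"
    by (simp add: F_def z_def)
  finally show ?thesis .
qed

section \<open>Gradients on Rn\<close>

text \<open>The whole line stays in \<open>Rn n\<close>, so a derivative relative to this subspace
  becomes an ordinary derivative in one real variable. This connects differentiability with the
  \<open>deriv\<close> in \<open>grad\<close> and \<open>jacobian_transp\<close>.\<close>

lemma Rn_has_derivative_along:
  fixes f :: "c00 \<Rightarrow> 'b :: real_normed_vector"
  assumes f: "(f has_derivative f') (at x within Rn n)" and "x \<in> Rn n" "v \<in> Rn n"
  shows "((\<lambda>t. f (x + t *\<^sub>R v)) has_derivative (\<lambda>t. t *\<^sub>R f' v)) (at 0)"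
proof -
  let ?g = "\<lambda>t. x + t *\<^sub>R v"
  have "(?g has_derivative (\<lambda>t. t *\<^sub>R v)) (at 0)" by (auto intro!: derivative_eq_intros)
  moreover have "range ?g \<subseteq> Rn n"
    using assms(2,3) by (auto intro!: subspace_add subspace_scale subspace_Rn)
  then have "(f has_derivative f') (at (?g 0) within range ?g)"
    using f by (auto intro: has_derivative_subset)
  ultimately have "((\<lambda>t. f (?g t)) has_derivative (\<lambda>t. f' (t *\<^sub>R v))) (at 0)"
    by (rule has_derivative_in_compose)
  moreover have "f' (t *\<^sub>R v) = t *\<^sub>R f' v" for t
    using has_derivative_linear[OF f] by (rule linear_cmul)
  ultimately show ?thesis by simp
qed

lemma Rn_has_real_derivative_along:
  fixes f :: "c00 \<Rightarrow> real"
  assumes "(f has_derivative f') (at x within Rn n)" "x \<in> Rn n" "v \<in> Rn n"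
  shows "((\<lambda>t. f (x + t *\<^sub>R v)) has_real_derivative f' v) (at 0)"
  using Rn_has_derivative_along[OF assms] by (simp add: has_field_derivative_def mult_commute_abs)

lemma grad_coord:
  assumes "(f has_derivative f') (at x within Rn n)" "x \<in> Rn n" "i < n"
  shows "coord (grad n f x) i = f' (unit_vec i)"
  using DERIV_imp_deriv[OF Rn_has_real_derivative_along[OF assms(1,2), of "unit_vec i"]] assms(3)
  by (simp add: grad_def)

lemma grad_in_Rn [simp]: "grad n f x \<in> Rn n"
  by (simp add: grad_def)

text \<open>A derivative relative to \<open>Rn n\<close> is determined only on \<open>Rn n\<close>,
  hence the restriction on \<open>v\<close>.\<close>

lemma grad_inner:
  assumes f: "(f has_derivative f') (at x within Rn n)" and "x \<in> Rn n" and v: "v \<in> Rn n"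
  shows "grad n f x \<bullet> v = f' v"
proof -
  have l: "linear f'" using f by (rule has_derivative_linear)
  have "f' v = f' (\<Sum>i<n. coord v i *\<^sub>R unit_vec i)"
    using v by (simp add: rvec_eq_sum[symmetric] rvec_coord)
  also have "\<dots> = (\<Sum>i<n. coord v i * f' (unit_vec i))"
    by (simp add: linear_sum[OF l] linear_cmul[OF l])
  also have "\<dots> = grad n f x \<bullet> v"
    using grad_coord[OF assms(1,2)] by (simp add: inner_Rn[of _ n] mult.commute)
  finally show ?thesis ..
qed

lemma grad_directional_derivative:
  fixes f :: "c00 \<Rightarrow> real"
  assumes "f differentiable (at x within Rn n)" "x \<in> Rn n" "v \<in> Rn n"
  shows "((\<lambda>t. (f (x + t *\<^sub>R v) - f x) / t) \<longlongrightarrow> grad n f x \<bullet> v) (at_right 0)"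
proof -
  obtain f' where f': "(f has_derivative f') (at x within Rn n)"
    using assms(1) by (auto simp: differentiable_def)
  have "((\<lambda>t. (f (x + t *\<^sub>R v) - f x) / t) \<longlongrightarrow> grad n f x \<bullet> v) (at 0)"
    using Rn_has_real_derivative_along[OF f' assms(2,3)] grad_inner[OF f' assms(2,3)] by (simp add: DERIV_def)
  then show ?thesis by (rule tendsto_mono[rotated]) (simp add: at_le)
qed

lemma convex_grad_le:
  fixes f :: "c00 \<Rightarrow> real"
  assumes cvx: "convex_on (Rn n) f" and "f differentiable (at x within Rn n)" and x: "x \<in> Rn n" and y: "y \<in> Rn n"
  shows "f x + grad n f x \<bullet> (y - x) \<le> f y"
proof -
  have "grad n f x \<bullet> (y - x) \<le> f y - f x"
  proof (rule tendsto_upperbound)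
    show "((\<lambda>t. (f (x + t *\<^sub>R (y - x)) - f x) / t) \<longlongrightarrow> grad n f x \<bullet> (y - x)) (at_right 0)"
      using assms by (intro grad_directional_derivative subspace_diff subspace_Rn)
    have "(f (x + t *\<^sub>R (y - x)) - f x) / t \<le> f y - f x" if t: "0 < t" "t < 1" for t
    proof -
      have "(1 - t) *\<^sub>R x + t *\<^sub>R y = x + t *\<^sub>R (y - x)" by (simp add: algebra_simps)
      then have "f (x + t *\<^sub>R (y - x)) - f x \<le> (f y - f x) * t"
        using convex_onD[OF cvx, of t x y] t x y by (simp add: left_diff_distrib right_diff_distrib mult.commute)
      then show ?thesis using t by (simp only: pos_divide_le_eq)
    qed
    then show "\<forall>\<^sub>F t in at_right 0. (f (x + t *\<^sub>R (y - x)) - f x) / t \<le> f y - f x"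
      by (intro eventually_at_rightI[of 0 1]) auto
  qed simp
  then show ?thesis by simp
qed

text \<open>Along the gradient itself the difference quotients tend to its squared norm, while the
  Lipschitz condition keeps them below \<open>M\<close> times its norm.\<close>

lemma norm_grad_le:
  fixes f :: "c00 \<Rightarrow> real"
  assumes lip: "M-lipschitz_on (Rn n) f" and "f differentiable (at x within Rn n)" and x: "x \<in> Rn n"
  shows "norm (grad n f x) \<le> M"
proof -
  let ?g = "grad n f x"
  have "?g \<bullet> ?g \<le> M * norm ?g"
  proof (rule tendsto_upperbound)
    show "((\<lambda>t. (f (x + t *\<^sub>R ?g) - f x) / t) \<longlongrightarrow> ?g \<bullet> ?g) (at_right 0)"
      using assms by (intro grad_directional_derivative) auto
    have "(f (x + t *\<^sub>R ?g) - f x) / t \<le> M * norm ?g" if t: "0 < t" "t < 1" for t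
    proof -
      have "x + t *\<^sub>R ?g \<in> Rn n" using x by (auto intro!: subspace_add subspace_scale subspace_Rn)
      from lipschitz_onD[OF lip this x] show ?thesis
        using t by (simp add: dist_norm pos_divide_le_eq abs_le_iff algebra_simps)
    qed
    then show "\<forall>\<^sub>F t in at_right 0. (f (x + t *\<^sub>R ?g) - f x) / t \<le> M * norm ?g"
      by (intro eventually_at_rightI[of 0 1]) auto
  qed simp
  then have "norm ?g * norm ?g \<le> M * norm ?g" by (simp add: dot_square_norm power2_eq_square)
  then show ?thesis using lipschitz_on_nonneg[OF lip] by (cases "norm ?g = 0") (auto simp: mult_le_cancel_right)
qed

text \<open>Convexity replaces integration along the segment: with the tangent inequality taken at
  \<open>y\<close>, only the change of the gradient between the endpoints remains. The price is
  \<open>L\<close> instead of \<open>L / 2\<close>.\<close>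

lemma smooth_convex_upper_bound:
  fixes f :: "c00 \<Rightarrow> real"
  assumes cvx: "convex_on (Rn n) f" and f: "f differentiable_on Rn n"
    and lip: "L-lipschitz_on (Rn n) (grad n f)" and x: "x \<in> Rn n" and y: "y \<in> Rn n"
  shows "f y \<le> f x + grad n f x \<bullet> (y - x) + L * (norm (y - x))\<^sup>2"
proof -
  have "f y + grad n f y \<bullet> (x - y) \<le> f x"
    using f x y by (intro convex_grad_le[OF cvx]) (auto simp: differentiable_on_def)
  moreover have "(grad n f y - grad n f x) \<bullet> (y - x) \<le> L * norm (y - x) * norm (y - x)"
    using norm_cauchy_schwarz[of "grad n f y - grad n f x" "y - x"] lipschitz_onD[OF lip y x]
      mult_right_mono[of "norm (grad n f y - grad n f x)" "L * norm (y - x)" "norm (y - x)"]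
    by (simp add: dist_norm)
  ultimately show ?thesis by (simp add: algebra_simps power2_eq_square)
qed

section \<open>Matrices and the chain rule\<close>

lemma bounded_linear_mat_vec: "bounded_linear (mat_vec p q A)"
  unfolding mat_vec_def[abs_def] rvec_eq_sum
  by (intro bounded_linear_sum bounded_linear_scaleR_const bounded_linear_const_mult bounded_linear_coord)

lemma norm_mat_vec_le: "norm (mat_vec p q A x) \<le> mat_norm p q A * norm x"
  unfolding mat_norm_def by (rule onorm[OF bounded_linear_mat_vec])

lemma mat_vec_diff: "mat_vec p q (\<lambda>i j. A i j - B i j) x = mat_vec p q A x - mat_vec p q B x"
  by (rule c00_eqI) (simp add: mat_vec_def algebra_simps sum_subtractf)

lemma
  fixes F :: "c00 \<Rightarrow> c00 \<Rightarrow> real"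
  assumes F: "(\<lambda>(u, y). F u y) differentiable_on (Rn p \<times> Rn q)"
    and h: "h differentiable_on Rn p" and hq: "\<And>u. u \<in> Rn p \<Longrightarrow> h u \<in> Rn q" and u: "u \<in> Rn p"
  shows composite_differentiable: "(\<lambda>u. F u (h u)) differentiable (at u within Rn p)"
    and composite_grad: "grad p (\<lambda>u. F u (h u)) u
      = grad p (\<lambda>u'. F u' (h u)) u + mat_vec p q (jacobian_transp h u) (grad q (F u) (h u))"
    and partial_differentiable: "F u differentiable (at (h u) within Rn q)"
proof -
  let ?F = "\<lambda>(u, y). F u y"
  have huq: "h u \<in> Rn q" using u by (rule hq)
  obtain F' where F': "(?F has_derivative F') (at (u, h u) within Rn p \<times> Rn q)"
    using F u huq unfolding differentiable_on_def differentiable_def by blast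
  obtain h' where h': "(h has_derivative h') (at u within Rn p)"
    using h u unfolding differentiable_on_def differentiable_def by blast
  \<comment> \<open>One chain rule serves three curves through \<open>(u, h u)\<close>: both
    components moving, only the input moving, only the output moving.\<close>
  have comp: "((\<lambda>x. F (a x) (b x)) has_derivative (\<lambda>v. F' (a' v, b' v))) (at x within S)"
    if "(a has_derivative a') (at x within S)" "(b has_derivative b') (at x within S)"
      and "a x = u" "b x = h u" "\<And>x. x \<in> S \<Longrightarrow> a x \<in> Rn p" "\<And>x. x \<in> S \<Longrightarrow> b x \<in> Rn q"
    for a b :: "c00 \<Rightarrow> c00" and a' b' x S
  proof -
    have "((\<lambda>x. (a x, b x)) has_derivative (\<lambda>v. (a' v, b' v))) (at x within S)"
      using that(1,2) by (rule has_derivative_Pair)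
    moreover have "(?F has_derivative F') (at (a x, b x) within (\<lambda>x. (a x, b x)) ` S)"
      unfolding that(3,4) using that(5,6) by (intro has_derivative_subset[OF F']) auto
    ultimately show ?thesis using has_derivative_in_compose by fastforce
  qed
  have d: "((\<lambda>u. F u (h u)) has_derivative (\<lambda>v. F' (v, h' v))) (at u within Rn p)"
    using comp[OF has_derivative_ident h'] hq by simp
  have d1: "((\<lambda>u'. F u' (h u)) has_derivative (\<lambda>v. F' (v, 0))) (at u within Rn p)"
    using comp[OF has_derivative_ident has_derivative_const] huq by simp
  have d2: "(F u has_derivative (\<lambda>v. F' (0, v))) (at (h u) within Rn q)"
    using comp[OF has_derivative_const has_derivative_ident] u by simp
  show "(\<lambda>u. F u (h u)) differentiable (at u within Rn p)" using d by (auto simp: differentiable_def)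
  show "F u differentiable (at (h u) within Rn q)" using d2 by (auto simp: differentiable_def)
  have h'c: "((\<lambda>t. coord (h (u + t *\<^sub>R unit_vec i)) j) has_real_derivative coord (h' (unit_vec i)) j) (at 0)"
    if "i < p" for i j
    using bounded_linear.has_derivative[OF bounded_linear_coord[of j] Rn_has_derivative_along[OF h' u, of "unit_vec i"]] that
    by (simp add: has_field_derivative_def mult_commute_abs)
  have jac: "jacobian_transp h u i j = coord (h' (unit_vec i)) j" if "i < p" for i j
    unfolding jacobian_transp_def by (rule DERIV_imp_deriv[OF h'c[OF that]])
  \<comment> \<open>Coordinates of \<open>h\<close> from \<open>q\<close> on vanish along the whole
    line, so the derivative stays in \<open>Rn q\<close>, where \<open>grad_inner\<close> applies to
    it.\<close>
  have h'q: "h' (unit_vec i) \<in> Rn q" if i: "i < p" for i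
  proof -
    have "coord (h' (unit_vec i)) j = 0" if j: "q \<le> j" for j
    proof -
      have "coord (h (u + t *\<^sub>R unit_vec i)) j = 0" for t
        using hq[of "u + t *\<^sub>R unit_vec i"] i j u
        by (auto simp: Rn_def)
      then show ?thesis using h'c[OF i, of j] by (auto dest: DERIV_unique[OF DERIV_const])
    qed
    then show ?thesis by (simp add: Rn_def)
  qed
  have "coord (grad p (\<lambda>u. F u (h u)) u) i
      = coord (grad p (\<lambda>u'. F u' (h u)) u + mat_vec p q (jacobian_transp h u) (grad q (F u) (h u))) i" for i
  proof (cases "i < p")
    case True
    have "F' (unit_vec i, h' (unit_vec i)) = F' ((unit_vec i, 0) + (0, h' (unit_vec i)))" by simp
    also have "\<dots> = F' (unit_vec i, 0) + F' (0, h' (unit_vec i))"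
      by (rule linear_add[OF has_derivative_linear[OF F']])
    also have "F' (0, h' (unit_vec i)) = h' (unit_vec i) \<bullet> grad q (F u) (h u)"
      using grad_inner[OF d2 huq h'q[OF True]] by (simp add: inner_commute)
    also have "\<dots> = coord (mat_vec p q (jacobian_transp h u) (grad q (F u) (h u))) i"
      using True h'q jac by (simp add: inner_Rn[of _ q] mat_vec_def)
    finally show ?thesis using grad_coord[OF d u True] grad_coord[OF d1 u True] by simp
  next
    case False
    then show ?thesis by (simp add: grad_def mat_vec_def)
  qed
  then show "grad p (\<lambda>u. F u (h u)) u
      = grad p (\<lambda>u'. F u' (h u)) u + mat_vec p q (jacobian_transp h u) (grad q (F u) (h u))"
    by (rule c00_eqI)
qed

section \<open>Model-based controller\<close>

text \<open>The constants for the single times are replaced by their suprema, which bound them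
  because the sequences are bounded. All later estimates see only these numbers, so their constants
  are uniform over instances.\<close>

lemma
  assumes "setting p q r U \<Phi> h d us G \<tau> D Rsup Lsup Msup M\<Phi>sup"
  shows setting_dims: "0 < p"
    and setting_U: "U \<subseteq> Rn p" "compact U" "convex U" "0 < D" "\<And>u u'. u \<in> U \<Longrightarrow> u' \<in> U \<Longrightarrow> norm (u - u') \<le> D"
    and setting_us: "us k \<in> U" "u \<in> U \<Longrightarrow> reduced \<Phi> h d k (us k) \<le> reduced \<Phi> h d k u"
    and setting_G: "0 \<le> G" "0 < \<tau>"
      "u \<in> U \<Longrightarrow> v \<in> Rn p \<Longrightarrow> norm v \<le> 1 \<Longrightarrow> \<bar>reduced \<Phi> h d k (u + \<tau> *\<^sub>R v)\<bar> \<le> G"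
    and setting_convex: "convex_on (Rn p) (reduced \<Phi> h d k)"
    and setting_differentiable: "reduced \<Phi> h d k differentiable_on Rn p"
    and setting_smooth: "Lsup-lipschitz_on (Rn p) (grad p (reduced \<Phi> h d k))"
    and setting_lipschitz: "Msup-lipschitz_on (Rn p) (reduced \<Phi> h d k)"
    and setting_lipschitz_output: "x \<in> Rn p \<Longrightarrow> M\<Phi>sup-lipschitz_on (Rn q) (\<Phi> k x)"
proof -
  note defs = setting_def plant_def differentiable_steady_state_map_def constraint_set_def bounded_objectives_def
  show "0 < p" "U \<subseteq> Rn p" "compact U" "convex U" "0 < D" "0 \<le> G" "0 < \<tau>"
    using assms unfolding defs by blast+
  show "norm (u - u') \<le> D" if "u \<in> U" "u' \<in> U" for u u'
    using assms that unfolding defs by blast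
  have "is_arg_min (reduced \<Phi> h d k) (\<lambda>u. u \<in> U) (us k)" using assms unfolding defs by blast
  then show "us k \<in> U" "u \<in> U \<Longrightarrow> reduced \<Phi> h d k (us k) \<le> reduced \<Phi> h d k u"
    by (auto simp: is_arg_min_def not_less)
  show "\<bar>reduced \<Phi> h d k (u + \<tau> *\<^sub>R v)\<bar> \<le> G" if "u \<in> U" "v \<in> Rn p" "norm v \<le> 1"
    using assms that unfolding defs by blast
  obtain L M M\<Phi> where reg: "regular_objectives p q \<Phi> h d L M M\<Phi>"
    and sup: "Lsup = (SUP k. L k)" "Msup = (SUP k. M k)" "M\<Phi>sup = (SUP k. M\<Phi> k)"
    using assms unfolding defs by blast
  have le: "L k \<le> Lsup" "M k \<le> Msup" "M\<Phi> k \<le> M\<Phi>sup"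
    using reg unfolding sup regular_objectives_def by (auto intro!: cSUP_upper bounded_imp_bdd_above)
  show "convex_on (Rn p) (reduced \<Phi> h d k)" using reg unfolding regular_objectives_def by blast
  show "Lsup-lipschitz_on (Rn p) (grad p (reduced \<Phi> h d k))"
    "Msup-lipschitz_on (Rn p) (reduced \<Phi> h d k)"
    "x \<in> Rn p \<Longrightarrow> M\<Phi>sup-lipschitz_on (Rn q) (\<Phi> k x)"
    using reg unfolding regular_objectives_def by (blast intro: lipschitz_on_le[OF _ le(1)] lipschitz_on_le[OF _ le(2)] lipschitz_on_le[OF _ le(3)])+
  have F: "(\<lambda>(u, y). \<Phi> k u y) differentiable_on Rn p \<times> Rn q"
    and h: "(\<lambda>u. h u (d k)) differentiable_on Rn p" and hq: "\<And>u. u \<in> Rn p \<Longrightarrow> h u (d k) \<in> Rn q"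
    using assms by (auto simp: setting_def plant_def differentiable_steady_state_map_def)
  have "(\<lambda>u. \<Phi> k u (h u (d k))) differentiable (at u within Rn p)" if "u \<in> Rn p" for u
    using F h hq that by (rule composite_differentiable)
  then show "reduced \<Phi> h d k differentiable_on Rn p"
    unfolding differentiable_on_def reduced_def[abs_def] by blast
qed

text \<open>A smaller radius is absorbed into the direction:
  \<open>(\<delta> / \<tau>) *\<^sub>R v\<close> still has norm at most one.\<close>

lemma setting_bounded:
  assumes S: "setting p q r U \<Phi> h d us G \<tau> D Rsup Lsup Msup M\<Phi>sup"
    and u: "u \<in> U" and v: "v \<in> Rn p" and "norm v \<le> 1" and \<delta>: "0 \<le> \<delta>" "\<delta> \<le> \<tau>"
  shows "\<bar>reduced \<Phi> h d k (u + \<delta> *\<^sub>R v)\<bar> \<le> G"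
proof -
  have \<tau>: "0 < \<tau>" using S by (rule setting_G)
  have "norm ((\<delta> / \<tau>) *\<^sub>R v) \<le> 1" using assms \<tau> mult_mono[of \<delta> \<tau> "norm v" 1] by simp
  then have "\<bar>reduced \<Phi> h d k (u + \<tau> *\<^sub>R ((\<delta> / \<tau>) *\<^sub>R v))\<bar> \<le> G"
    using S u v by (intro setting_G subspace_scale subspace_Rn)
  then show ?thesis using \<tau> by simp
qed

lemma setting_bounded_U:
  assumes S: "setting p q r U \<Phi> h d us G \<tau> D Rsup Lsup Msup M\<Phi>sup" and u: "u \<in> U"
  shows "\<bar>reduced \<Phi> h d k u\<bar> \<le> G"
  using setting_bounded[OF S u subspace_0[OF subspace_Rn], of 0] setting_G(2)[OF S] by simp

lemma path_length_nonneg: "0 \<le> path_length us T"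
  by (simp add: path_length_def sum_nonneg)

lemma model_based_regret:
  assumes S: "setting p q r U \<Phi> h d us G \<tau> D Rsup Lsup Msup M\<Phi>sup"
    and loop: "model_based_loop p q U \<Phi> h d \<eta> H w u y"
    and err: "\<And>k. sensitivity_error p q h d H u k \<le> e k" and eE: "\<And>k. e k \<le> E"
    and \<eta>: "0 < \<eta>" and T: "0 < T"
  shows "dynamic_regret (reduced \<Phi> h d) (\<lambda>k. reduced \<Phi> h d k (w k)) us T
    \<le> (D\<^sup>2 + 2 * D * path_length us T) / (2 * \<eta>) + \<eta> / 2 * (real T * (Msup + M\<Phi>sup * E)\<^sup>2)
      + D * M\<Phi>sup * (\<Sum>k=1..T. e k)"
proof -
  note U = setting_U[OF S]
  define f where "f = reduced \<Phi> h d"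
  define g where "g k = grad p (\<lambda>u'. \<Phi> k u' (y k)) (u k) + mat_vec p q (H k) (grad q (\<lambda>y'. \<Phi> k (u k) y') (y k))" for k
  have w0: "w 0 \<in> U" and uw: "u k = w k" and y: "y k = h (w k) (d k)"
    and w: "w (Suc k) = proj U (w k - \<eta> *\<^sub>R g k)" for k
    using loop unfolding model_based_loop_def g_def by auto
  have wU: "w k \<in> U" for k using w0 w proj_nearest(1)[OF U(2)] by (cases k) auto
  have wR: "w k \<in> Rn p" for k using wU U(1) by auto
  have ge: "norm (g k - grad p (f k) (w k)) \<le> M\<Phi>sup * e k" for k
  proof -
    let ?J = "jacobian_transp (\<lambda>u'. h u' (d k)) (w k)" and ?b = "grad q (\<Phi> k (w k)) (y k)"
    have dk: "d k \<in> Rn r" and F: "(\<lambda>(u, y). \<Phi> k u y) differentiable_on Rn p \<times> Rn q"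
      and h: "(\<lambda>u. h u (d k)) differentiable_on Rn p" and hq: "\<And>u. u \<in> Rn p \<Longrightarrow> h u (d k) \<in> Rn q"
      using S by (auto simp: setting_def plant_def differentiable_steady_state_map_def)
    have "grad p (f k) (w k) = grad p (\<lambda>u'. \<Phi> k u' (y k)) (w k) + mat_vec p q ?J ?b"
      using composite_grad[OF F h hq wR] by (simp add: f_def reduced_def[abs_def] y)
    then have "g k - grad p (f k) (w k) = mat_vec p q (\<lambda>i j. H k i j - ?J i j) ?b"
      by (simp add: g_def uw mat_vec_diff)
    then have "norm (g k - grad p (f k) (w k)) \<le> sensitivity_error p q h d H u k * norm ?b"
      using norm_mat_vec_le[of p q "\<lambda>i j. H k i j - ?J i j" ?b] by (simp add: sensitivity_error_def uw)
    also have "\<dots> \<le> e k * M\<Phi>sup"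
    proof (intro mult_mono err)
      show "norm ?b \<le> M\<Phi>sup"
        using hq[OF wR] partial_differentiable[OF F h hq wR] unfolding y
        by (intro norm_grad_le setting_lipschitz_output[OF S wR])
      show "0 \<le> e k"
        using err[of k] onorm_pos_le[OF bounded_linear_mat_vec]
        by (auto simp: sensitivity_error_def mat_norm_def intro: order_trans)
    qed simp
    finally show ?thesis by (simp add: mult.commute)
  qed
  have M\<Phi>: "0 \<le> M\<Phi>sup" using setting_lipschitz_output[OF S wR] by (rule lipschitz_on_nonneg)
  have "f k (w k) - f k (us k) \<le> g k \<bullet> (w k - us k) + D * M\<Phi>sup * e k" for k
  proof -
    have "f k (w k) + grad p (f k) (w k) \<bullet> (us k - w k) \<le> f k (us k)"
      using setting_differentiable[OF S, of k] setting_us(1)[OF S, of k] U(1) wR unfolding f_def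
      by (intro convex_grad_le[OF setting_convex[OF S]]) (auto simp: differentiable_on_def)
    moreover have "(g k - grad p (f k) (w k)) \<bullet> (us k - w k) \<le> M\<Phi>sup * e k * D"
    proof -
      have "(g k - grad p (f k) (w k)) \<bullet> (us k - w k) \<le> norm (g k - grad p (f k) (w k)) * norm (us k - w k)"
        by (rule norm_cauchy_schwarz)
      also have "\<dots> \<le> M\<Phi>sup * e k * D"
        using ge[of k] U(5)[OF setting_us(1)[OF S] wU] by (intro mult_mono) (auto intro: order_trans[OF norm_ge_zero])
      finally show ?thesis .
    qed
    ultimately show ?thesis by (simp add: algebra_simps)
  qed
  then have regret: "dynamic_regret f (\<lambda>k. f k (w k)) us T \<le> (\<Sum>k=1..T. g k \<bullet> (w k - us k) + D * M\<Phi>sup * e k)"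
    unfolding dynamic_regret_def by (intro sum_mono)
  have split: "(\<Sum>k=1..T. g k \<bullet> (w k - us k) + D * M\<Phi>sup * e k)
      = (\<Sum>k=1..T. g k \<bullet> (w k - us k)) + D * M\<Phi>sup * (\<Sum>k=1..T. e k)"
    by (simp add: sum.distrib sum_distrib_left)
  have ogd: "(\<Sum>k=1..T. g k \<bullet> (w k - us k))
      \<le> (D\<^sup>2 + 2 * D * path_length us T) / (2 * \<eta>) + \<eta> / 2 * (\<Sum>k=1..T. (norm (g k))\<^sup>2)"
    using U setting_us(1)[OF S] w0 w \<eta> T by (intro projected_gradient_regret[of U]) auto
  have "(\<Sum>k=1..T. (norm (g k))\<^sup>2) \<le> (\<Sum>k=1..T. (Msup + M\<Phi>sup * E)\<^sup>2)"
  proof (intro sum_mono power_mono norm_ge_zero)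
    fix k
    have "norm (grad p (f k) (w k)) \<le> Msup"
      using setting_differentiable[OF S, of k] wR[of k] setting_lipschitz[OF S, of k] unfolding f_def
      by (intro norm_grad_le) (auto simp: differentiable_on_def)
    moreover have "M\<Phi>sup * e k \<le> M\<Phi>sup * E" using eE M\<Phi> by (intro mult_left_mono)
    ultimately show "norm (g k) \<le> Msup + M\<Phi>sup * E"
      using ge[of k] norm_triangle_ineq2[of "g k" "grad p (f k) (w k)"] by linarith
  qed
  then have "\<eta> / 2 * (\<Sum>k=1..T. (norm (g k))\<^sup>2) \<le> \<eta> / 2 * (real T * (Msup + M\<Phi>sup * E)\<^sup>2)"
    using \<eta> by (intro mult_left_mono) simp_all
  then show ?thesis using regret ogd unfolding split f_def by linarith
qed

text \<open>The error regimes differ only in \<open>\<rho>\<close>, a growth that dominates both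
  \<open>sqrt T\<close> and the accumulated sensitivity errors. With
  \<open>\<eta> = 1 / sqrt T\<close> every other term is a multiple of \<open>sqrt T\<close> or of
  \<open>sqrt T * CT\<close>.\<close>

lemma model_based_regret_boundI:
  assumes sum_le: "\<And>T. 0 < T \<Longrightarrow> (\<Sum>k=1..T. e k) \<le> K * \<rho> T" and eE: "\<And>k. e k \<le> E"
    and \<rho>: "\<And>T. 0 < T \<Longrightarrow> sqrt (real T) \<le> \<rho> T" and K: "0 \<le> K"
    and rate: "\<And>T CT. 0 \<le> CT \<Longrightarrow> 0 < T \<Longrightarrow> sqrt (real T) * CT + \<rho> T \<le> rate T CT"
  shows "model_based_regret_bound e rate G \<tau> D Rsup Lsup Msup M\<Phi>sup"
  unfolding model_based_regret_bound_def
\<comment> \<open>The summands are the coefficients of the initial distance, the path length, the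
  squared estimates and the accumulated errors. The signs of \<open>D\<close> and
  \<open>M\<Phi>sup\<close> become known only from an instance of \<open>setting\<close>, after the
  constant is fixed.\<close>
proof (intro exI[of _ "D\<^sup>2 / 2 + D + (Msup + M\<Phi>sup * E)\<^sup>2 / 2 + D * M\<Phi>sup * K"] exI[of _ 0] allI impI)
  fix p q r :: nat and U \<Phi> h d us and T :: nat and H w u y
  assume S: "setting p q r U \<Phi> h d us G \<tau> D Rsup Lsup Msup M\<Phi>sup" and T: "0 < T"
    and loop: "model_based_loop p q U \<Phi> h d (1 / sqrt (real T)) H w u y"
    and err: "\<forall>k. sensitivity_error p q h d H u k \<le> e k"
  let ?CT = "path_length us T" and ?s = "sqrt (real T)"
  let ?A = "(Msup + M\<Phi>sup * E)\<^sup>2"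
  have D: "0 < D" using S by (rule setting_U)
  have M\<Phi>: "0 \<le> M\<Phi>sup"
    using setting_lipschitz_output[OF S, of 0 0] subspace_0[OF subspace_Rn] by (auto dest: lipschitz_on_nonneg)
  have CT: "0 \<le> ?CT" by (rule path_length_nonneg)
  have s: "0 < ?s" using T by simp
  have r: "0 \<le> \<rho> T" "?s \<le> \<rho> T" using \<rho>[OF T] s by linarith+
  define x where "x = ?s * ?CT + \<rho> T"
  have x: "?s \<le> x" "?s * ?CT \<le> x" "\<rho> T \<le> x" "0 \<le> x"
    using r s CT mult_nonneg_nonneg[of ?s ?CT] unfolding x_def by linarith+
  have "dynamic_regret (reduced \<Phi> h d) (\<lambda>k. reduced \<Phi> h d k (w k)) us T
      \<le> (D\<^sup>2 + 2 * D * ?CT) / (2 * (1 / ?s)) + (1 / ?s) / 2 * (real T * ?A) + D * M\<Phi>sup * (\<Sum>k=1..T. e k)"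
    using S loop err eE s T by (intro model_based_regret) auto
  moreover have "(D\<^sup>2 + 2 * D * ?CT) / (2 * (1 / ?s)) = D\<^sup>2 / 2 * ?s + D * (?s * ?CT)"
    by (simp add: field_simps)
  moreover have "(1 / ?s) / 2 * (real T * ?A) = ?A / 2 * ?s"
  proof -
    have "(1 / ?s) / 2 * (real T * ?A) = ?A / 2 * (real T / ?s)" by (simp add: mult.commute)
    then show ?thesis by (simp only: real_div_sqrt[OF of_nat_0_le_iff])
  qed
  moreover have "D\<^sup>2 / 2 * ?s \<le> D\<^sup>2 / 2 * x" using x(1) by (intro mult_left_mono) simp_all
  moreover have "D * (?s * ?CT) \<le> D * x" using x(2) D by (intro mult_left_mono) simp_all
  moreover have "?A / 2 * ?s \<le> ?A / 2 * x" using x(1) by (intro mult_left_mono) simp_all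
  moreover have "D * M\<Phi>sup * (\<Sum>k=1..T. e k) \<le> D * M\<Phi>sup * (K * \<rho> T)"
    using D M\<Phi> sum_le[OF T] by (intro mult_left_mono) simp_all
  moreover have "D * M\<Phi>sup * (K * \<rho> T) \<le> D * M\<Phi>sup * (K * x)"
    using D M\<Phi> K x(3) by (intro mult_left_mono) simp_all
  ultimately have "dynamic_regret (reduced \<Phi> h d) (\<lambda>k. reduced \<Phi> h d k (w k)) us T
      \<le> D\<^sup>2 / 2 * x + D * x + ?A / 2 * x + D * M\<Phi>sup * (K * x)"
    by linarith
  also have "\<dots> = (D\<^sup>2 / 2 + D + ?A / 2 + D * M\<Phi>sup * K) * x"
    by (simp only: distrib_right mult.assoc)
  also have "\<dots> \<le> (D\<^sup>2 / 2 + D + ?A / 2 + D * M\<Phi>sup * K) * rate T ?CT"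
    using D M\<Phi> K rate[OF CT T] unfolding x_def by (intro mult_left_mono) simp_all
  finally show "dynamic_regret (reduced \<Phi> h d) (\<lambda>k. reduced \<Phi> h d k (w k)) us T
      \<le> (D\<^sup>2 / 2 + D + ?A / 2 + D * M\<Phi>sup * K) * rate T ?CT" .
qed

text \<open>For \<open>s = 1/2\<close> the sum telescopes through square roots; smaller exponents
  follow on multiplying by \<open>a powr (1/2 - s)\<close>, which grows with \<open>a\<close>. The
  restriction \<open>s \<le> 1/2\<close> lets the constant 2 serve all exponents.\<close>

lemma sum_inverse_powr_le:
  assumes s: "0 \<le> s" "s \<le> 1/2"
  shows "(\<Sum>k=1..T. 1 / (real k + 1) powr s) \<le> 2 * real T powr (1 - s)"
proof (induction T)
  case (Suc T)
  define a where "a = real T + 1"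
  have a: "1 \<le> a" "real T \<le> a" by (auto simp: a_def)
  have half: "1 / sqrt a \<le> 2 * (sqrt a - sqrt (real T))"
  proof -
    have "(sqrt a - sqrt (real T)) * (sqrt a + sqrt (real T)) = 1"
      by (simp add: a_def algebra_simps)
    moreover have "(sqrt a - sqrt (real T)) * (sqrt a + sqrt (real T)) \<le> (sqrt a - sqrt (real T)) * (2 * sqrt a)"
      using a by (intro mult_left_mono) auto
    ultimately show ?thesis using a by (simp add: pos_divide_le_eq mult.commute mult.left_commute)
  qed
  have "real T powr (1 - s) = real T powr (1/2 - s) * sqrt (real T)"
    by (simp add: powr_half_sqrt[symmetric] flip: powr_add)
  also have "\<dots> \<le> a powr (1/2 - s) * sqrt (real T)"
    using s a by (intro mult_right_mono powr_mono2) auto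
  finally have 1: "real T powr (1 - s) \<le> a powr (1/2 - s) * sqrt (real T)" .
  have 2: "a powr (1 - s) = a powr (1/2 - s) * sqrt a"
    using a by (simp add: powr_half_sqrt[symmetric] flip: powr_add)
  have 3: "1 / a powr s = a powr (1/2 - s) * (1 / sqrt a)"
    using a by (simp add: powr_half_sqrt[symmetric] powr_diff)
  \<comment> \<open>The new summand has base \<open>T + 2\<close>; lowering it to
    \<open>a = T + 1\<close> aligns it with the telescoping difference.\<close>
  have "1 / (real (Suc T) + 1) powr s \<le> 1 / a powr s"
    using a s by (intro divide_left_mono powr_mono2 mult_pos_pos) (auto simp: a_def)
  also have "\<dots> \<le> a powr (1/2 - s) * (2 * (sqrt a - sqrt (real T)))"
    unfolding 3 using half by (intro mult_left_mono) auto
  also have "\<dots> \<le> 2 * a powr (1 - s) - 2 * real T powr (1 - s)"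
    using 1 unfolding 2 by (simp add: algebra_simps)
  finally show ?case using Suc by (simp add: a_def add.commute)
qed simp

text \<open>Errors that decay faster than \<open>k powr (- 1/2)\<close> are weakened to exponent
  \<open>1/2\<close>, since \<open>sqrt T\<close> is already the order of the other terms. One
  exponent \<open>1 - min \<theta> (1/2)\<close> thus covers slow and fast decay.\<close>

lemma model_based_regret_bound_decaying:
  assumes \<theta>: "0 < \<theta>" and \<epsilon>: "0 < \<epsilon>"
    and rate: "\<And>T CT. 0 \<le> CT \<Longrightarrow> 0 < T \<Longrightarrow> sqrt (real T) * CT + real T powr (1 - min \<theta> (1/2)) \<le> rate T CT"
  shows "model_based_regret_bound (\<lambda>k. \<epsilon> / (real k + 1) powr \<theta>) rate G \<tau> D Rsup Lsup Msup M\<Phi>sup"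
proof (rule model_based_regret_boundI[where \<rho> = "\<lambda>T. real T powr (1 - min \<theta> (1/2))" and K = "2 * \<epsilon>" and E = \<epsilon>])
  fix T :: nat assume T: "0 < T"
  let ?s = "min \<theta> (1/2)"
  have "(\<Sum>k=1..T. \<epsilon> / (real k + 1) powr \<theta>) \<le> (\<Sum>k=1..T. \<epsilon> * (1 / (real k + 1) powr ?s))"
  proof (rule sum_mono)
    fix k
    have "(real k + 1) powr ?s \<le> (real k + 1) powr \<theta>" by (intro powr_mono) auto
    then show "\<epsilon> / (real k + 1) powr \<theta> \<le> \<epsilon> * (1 / (real k + 1) powr ?s)"
      using \<epsilon> by (simp add: frac_le)
  qed
  also have "\<dots> = \<epsilon> * (\<Sum>k=1..T. 1 / (real k + 1) powr ?s)" by (simp only: sum_distrib_left)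
  also have "\<dots> \<le> \<epsilon> * (2 * real T powr (1 - ?s))"
    using \<theta> \<epsilon> by (intro mult_left_mono sum_inverse_powr_le) auto
  finally show "(\<Sum>k=1..T. \<epsilon> / (real k + 1) powr \<theta>) \<le> 2 * \<epsilon> * real T powr (1 - ?s)" by simp
  show "sqrt (real T) \<le> real T powr (1 - ?s)"
    using T by (subst powr_half_sqrt[symmetric]) (auto intro!: powr_mono)
next
  fix k
  have "1 \<le> (real k + 1) powr \<theta>" using \<theta> by (intro ge_one_powr_ge_zero) auto
  then show "\<epsilon> / (real k + 1) powr \<theta> \<le> \<epsilon>" using frac_le[of \<epsilon> \<epsilon> 1 "(real k + 1) powr \<theta>"] \<epsilon> by simp
qed (use \<epsilon> rate in auto)

lemma model_based_regret_bound_constant: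
  assumes \<epsilon>: "0 < \<epsilon>"
  shows "model_based_regret_bound (\<lambda>k. \<epsilon>) (\<lambda>T CT. sqrt (real T) * (CT + 1) + real T) G \<tau> D Rsup Lsup Msup M\<Phi>sup"
proof (rule model_based_regret_boundI[where \<rho> = real and K = \<epsilon> and E = \<epsilon>])
  fix T :: nat assume "0 < T"
  then show "sqrt (real T) \<le> real T" by (intro real_le_lsqrt) (auto simp: power2_eq_square)
qed (use \<epsilon> in \<open>auto simp: algebra_simps\<close>)

section \<open>Model-free controller\<close>

text \<open>Fubini with coordinate \<open>k\<close> split off the infinite product. It plays the
  part of conditioning on all other coordinates: inequalities between the inner means
  suffice.\<close>

lemma integral_resample_mono:
  fixes F g :: "('i \<Rightarrow> 'a) \<Rightarrow> real"
  assumes M: "\<And>i. prob_space (M i)"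
    and F: "integrable (Pi\<^sub>M UNIV M) F" and g: "integrable (Pi\<^sub>M UNIV M) g"
    and le: "\<And>v. v \<in> space (Pi\<^sub>M UNIV M) \<Longrightarrow> (\<integral>s. F (v(k := s)) \<partial>M k) \<le> (\<integral>s. g (v(k := s)) \<partial>M k)"
  shows "(\<integral>v. F v \<partial>Pi\<^sub>M UNIV M) \<le> (\<integral>v. g v \<partial>Pi\<^sub>M UNIV M)"
proof -
  let ?N = "Pi\<^sub>M (UNIV - {k}) M" and ?P = "Pi\<^sub>M UNIV M"
  let ?upd = "\<lambda>(s, X). X(k := s)"
  interpret K: prob_space "M k" by (rule M)
  interpret N: prob_space ?N using M by (intro prob_space_PiM)
  interpret pair_sigma_finite "M k" ?N by standard
  have ins: "insert k (UNIV - {k}) = UNIV" by auto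
  have P: "?P = distr (M k \<Otimes>\<^sub>M ?N) ?P ?upd"
    using distr_pair_PiM_eq_PiM[of "UNIV - {k}" M k] M unfolding ins by simp
  have upd: "?upd \<in> M k \<Otimes>\<^sub>M ?N \<rightarrow>\<^sub>M ?P"
    using measurable_fun_upd[of UNIV "UNIV - {k}" k snd "M k \<Otimes>\<^sub>M ?N" M fst]
    by (simp add: ins split_beta')
  have fubini: "integrable ?N (\<lambda>X. \<integral>s. G (X(k := s)) \<partial>M k)"
      "(\<integral>v. G v \<partial>?P) = (\<integral>X. \<integral>s. G (X(k := s)) \<partial>M k \<partial>?N)" if G: "integrable ?P G" for G :: "('i \<Rightarrow> 'a) \<Rightarrow> real"
  proof -
    have "integrable (distr (M k \<Otimes>\<^sub>M ?N) ?P ?upd) G" using G P by simp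
    then have i: "integrable (M k \<Otimes>\<^sub>M ?N) (\<lambda>(s, X). G (X(k := s)))"
      using integrable_distr[OF upd, of G] by (simp add: split_beta')
    show "integrable ?N (\<lambda>X. \<integral>s. G (X(k := s)) \<partial>M k)" using integrable_snd[OF i] .
    have "(\<integral>v. G v \<partial>?P) = (\<integral>v. G v \<partial>distr (M k \<Otimes>\<^sub>M ?N) ?P ?upd)" using P by simp
    also have "\<dots> = (\<integral>z. G (?upd z) \<partial>(M k \<Otimes>\<^sub>M ?N))"
      using G by (intro integral_distr upd) simp
    also have "\<dots> = (\<integral>X. \<integral>s. G (X(k := s)) \<partial>M k \<partial>?N)"
      using integral_snd[OF i] by (simp add: split_beta')
    finally show "(\<integral>v. G v \<partial>?P) = (\<integral>X. \<integral>s. G (X(k := s)) \<partial>M k \<partial>?N)" .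
  qed
  have "(\<integral>X. \<integral>s. F (X(k := s)) \<partial>M k \<partial>?N) \<le> (\<integral>X. \<integral>s. g (X(k := s)) \<partial>M k \<partial>?N)"
  proof (rule integral_mono[OF fubini(1)[OF F] fubini(1)[OF g]])
    fix X assume X: "X \<in> space ?N"
    \<comment> \<open>Points of \<open>space ?N\<close> are \<open>undefined\<close> at
      \<open>k\<close>. Any \<open>s0\<close> completes them to points of the full product and is
      overwritten again by the resampling.\<close>
    obtain s0 where "s0 \<in> space (M k)" using K.not_empty by blast
    then have "X(k := s0) \<in> space ?P" using X by (auto simp: space_PiM PiE_iff)
    from le[OF this] show "(\<integral>s. F (X(k := s)) \<partial>M k) \<le> (\<integral>s. g (X(k := s)) \<partial>M k)" by simp
  qed
  then show ?thesis using fubini(2)[OF F] fubini(2)[OF g] by simp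
qed

text \<open>Truncation to \<open>Rn n\<close> is linear and nonexpansive, so composing with it
  extends an objective to the ambient space and keeps convexity and the Lipschitz constant. The
  smoothing inequality and Borel measurability are stated for such global functions.\<close>

lemma convex_on_Rn_extend:
  assumes "convex_on (Rn n) f"
  shows "convex_on UNIV (\<lambda>x. f (rvec n (coord x)))"
proof (rule convex_onI)
  fix t :: real and x y assume t: "0 < t" "t < 1"
  have "rvec n (coord ((1 - t) *\<^sub>R x + t *\<^sub>R y)) = (1 - t) *\<^sub>R rvec n (coord x) + t *\<^sub>R rvec n (coord y)"
    by (rule c00_eqI) simp
  then show "f (rvec n (coord ((1 - t) *\<^sub>R x + t *\<^sub>R y)))
      \<le> (1 - t) * f (rvec n (coord x)) + t * f (rvec n (coord y))"
    using convex_onD[OF assms, of t "rvec n (coord x)" "rvec n (coord y)"] t by simp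
qed simp

lemma lipschitz_on_Rn_extend:
  assumes "M-lipschitz_on (Rn n) f"
  shows "M-lipschitz_on UNIV (\<lambda>x. f (rvec n (coord x)))"
proof (rule lipschitz_onI)
  fix x y
  have "rvec n (coord x) - rvec n (coord y) = rvec n (coord (x - y))" by (rule c00_eqI) simp
  then have "dist (rvec n (coord x)) (rvec n (coord y)) \<le> dist x y"
    by (simp add: dist_norm norm_rvec_coord_le)
  then show "dist (f (rvec n (coord x))) (f (rvec n (coord y))) \<le> M * dist x y"
    using lipschitz_onD[OF assms, of "rvec n (coord x)" "rvec n (coord y)"]
      mult_left_mono[OF _ lipschitz_on_nonneg[OF assms]] by (meson order_trans rvec_in_Rn)
qed (rule lipschitz_on_nonneg[OF assms])

lemma model_free_regret:
  assumes S: "setting p q r U \<Phi> h d us G \<tau> D Rsup Lsup Msup M\<Phi>sup"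
    and w0: "w0 \<in> U" and \<eta>: "0 < \<eta>" and \<delta>: "0 < \<delta>" "\<delta> \<le> \<tau>" and T: "0 < T"
    and loop: "\<forall>v \<in> space (exploration p). model_free_loop p U \<Phi> h d \<eta> \<delta> w0 \<phi>0 v (w v) (u v) (y v)"
  shows "dynamic_regret (reduced \<Phi> h d) (\<lambda>k. \<integral>v. reduced \<Phi> h d k (w v k) \<partial>exploration p) us T
      \<le> (D\<^sup>2 + 2 * D * path_length us T) / (2 * \<eta>) + \<eta> / 2 * (real T * (real p / \<delta> * (2 * G))\<^sup>2) + real T * (Lsup * \<delta>\<^sup>2)"
    and "dynamic_regret (reduced \<Phi> h d) (\<lambda>k. \<integral>v. reduced \<Phi> h d k (w v k) \<partial>exploration p) us T \<le> 2 * G * real T"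
proof -
  let ?M = "exploration p"
  define f where "f = reduced \<Phi> h d"
  define fe where "fe k x = f k (rvec p (coord x))" for k x
  note U = setting_U[OF S] and us = setting_us[OF S]
  have p: "0 < p" using S by (rule setting_dims)
  have Une: "U \<noteq> {}" using w0 by auto
  have fe: "fe k x = f k x" if "x \<in> Rn p" for k x using that by (simp add: fe_def rvec_coord)
  have fe_cvx: "convex_on UNIV (fe k)" for k
    unfolding fe_def f_def by (intro convex_on_Rn_extend setting_convex[OF S])
  have fe_lip: "Msup-lipschitz_on UNIV (fe k)" for k
    unfolding fe_def f_def by (intro lipschitz_on_Rn_extend setting_lipschitz[OF S])
  have fe_meas [measurable]: "fe k \<in> borel_measurable borel" for k
    using fe_lip by (rule lipschitz_on_borel_measurable)
  have proj_meas [measurable]: "proj U \<in> borel_measurable borel"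
    using U Une by (intro proj_measurable)
  interpret prob_space ?M
    unfolding exploration_def using prob_space_uniform_sphere[OF p] by (intro prob_space_PiM)
  have sp: "v \<in> space ?M \<longleftrightarrow> (\<forall>k. v k \<in> unit_sphere p)" for v
    by (simp add: exploration_def space_PiM PiE_iff)
  have v_Rn: "v k \<in> Rn p" "norm (v k) = 1" if "v \<in> space ?M" for v k
    using that sp unit_sphere_def by auto
  have v_meas [measurable]: "(\<lambda>v. v k) \<in> borel_measurable ?M" for k
  proof -
    have "id \<circ> (\<lambda>v. v k) \<in> borel_measurable ?M"
      unfolding exploration_def
      by (rule measurable_comp[OF _ uniform_sphere_measurable_borel[of p]]) simp
    then show ?thesis by (simp add: comp_def)
  qed
  define pv where "pv v k = (case k of 0 \<Rightarrow> \<phi>0 | Suc j \<Rightarrow> fe j (w v j + \<delta> *\<^sub>R v j))" for v k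
  define \<phi> where "\<phi> v k = (real p / \<delta> * (fe k (w v k + \<delta> *\<^sub>R v k) - pv v k)) *\<^sub>R v k" for v k
  have loopE: "w v 0 = w0" "u v k = w v k + \<delta> *\<^sub>R v k" "y v k = h (u v k) (d k)"
      "w v (Suc k) = proj U (w v k - \<eta> *\<^sub>R ((real p / \<delta> * (\<Phi> k (u v k) (y v k)
        - (case k of 0 \<Rightarrow> \<phi>0 | Suc j \<Rightarrow> \<Phi> j (u v j) (y v j)))) *\<^sub>R v k))" if "v \<in> space ?M" for v k
    using bspec[OF loop that] unfolding model_free_loop_def Let_def by blast+
  have wU: "w v k \<in> U" if v: "v \<in> space ?M" for v k
    using loopE(1)[OF v] loopE(4)[OF v] w0 proj_nearest(1)[OF U(2) Une] by (cases k) auto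
  have wR: "w v k \<in> Rn p" if "v \<in> space ?M" for v k using wU[OF that] U(1) by auto
  have uR: "w v k + \<delta> *\<^sub>R v k \<in> Rn p" if "v \<in> space ?M" for v k
    using wR[OF that] v_Rn[OF that] by (intro subspace_add subspace_scale subspace_Rn)
  have \<Phi>: "\<Phi> k (u v k) (y v k) = fe k (w v k + \<delta> *\<^sub>R v k)" if v: "v \<in> space ?M" for v k
    using uR[OF v] loopE(2,3)[OF v] by (simp add: fe f_def reduced_def)
  have w_Suc: "w v (Suc k) = proj U (w v k - \<eta> *\<^sub>R \<phi> v k)" if v: "v \<in> space ?M" for v k
    using loopE(4)[OF v, of k] by (simp add: \<Phi>[OF v] \<phi>_def pv_def cong: nat.case_cong)
  have bnd: "\<bar>fe k (w v k + \<delta> *\<^sub>R v k)\<bar> \<le> G" if v: "v \<in> space ?M" for v k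
    using uR[OF v] wU[OF v] v_Rn[OF v] \<delta> unfolding f_def
    by (simp add: fe f_def) (intro setting_bounded[OF S], auto)
  have fw: "\<bar>f k x\<bar> \<le> G" if "x \<in> U" for k x
    unfolding f_def using S that by (rule setting_bounded_U)
  \<comment> \<open>The two claims are proved by a joint induction because
    \<open>w v (Suc k)\<close> depends on both \<open>w v k\<close> and \<open>pv v k\<close>. The
    loop equations hold only on the space of the measure, hence the use of
    \<open>measurable_cong\<close>.\<close>
  have w_meas [measurable]: "(\<lambda>v. w v k) \<in> borel_measurable ?M"
    and pv_meas [measurable]: "(\<lambda>v. pv v k) \<in> borel_measurable ?M" for k
  proof (induction k)
    case 0
    have "(\<lambda>v. w v 0) \<in> borel_measurable ?M \<longleftrightarrow> (\<lambda>v. w0) \<in> borel_measurable ?M"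
      by (rule measurable_cong) (rule loopE)
    then show "(\<lambda>v. w v 0) \<in> borel_measurable ?M" by simp
    show "(\<lambda>v. pv v 0) \<in> borel_measurable ?M" by (simp add: pv_def)
  next
    case (Suc k)
    note [measurable] = Suc
    have "(\<lambda>v. proj U (w v k - \<eta> *\<^sub>R \<phi> v k)) \<in> borel_measurable ?M"
      unfolding \<phi>_def by measurable
    then show "(\<lambda>v. w v (Suc k)) \<in> borel_measurable ?M"
      using measurable_cong[of ?M "\<lambda>v. w v (Suc k)" "\<lambda>v. proj U (w v k - \<eta> *\<^sub>R \<phi> v k)"] w_Suc by simp
    show "(\<lambda>v. pv v (Suc k)) \<in> borel_measurable ?M" unfolding pv_def by simp
  qed
  have \<phi>_meas [measurable]: "(\<lambda>v. \<phi> v k) \<in> borel_measurable ?M" for k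
    unfolding \<phi>_def by measurable
  \<comment> \<open>Neither the iterate at time \<open>k\<close> nor the previous measurement
    depends on \<open>v k\<close>. When \<open>v k\<close> is resampled, both stay fixed and the
    previous measurement acts as a constant baseline.\<close>
  have causal: "w v k = w v' k \<and> pv v k = pv v' k"
    if v: "v \<in> space ?M" "v' \<in> space ?M" and eq: "\<And>j. j < k \<Longrightarrow> v j = v' j" for v v' k
    using eq
  proof (induction k)
    case 0
    then show ?case using loopE(1) v by (simp add: pv_def)
  next
    case (Suc k)
    then have "w v k = w v' k \<and> pv v k = pv v' k" "v k = v' k" by auto
    then show ?case using w_Suc v by (simp add: \<phi>_def pv_def[of _ "Suc k"])
  qed
  \<comment> \<open>For \<open>k = 0\<close> the difference would involve the arbitrary
    \<open>\<phi>0\<close>; for \<open>0 < k\<close> both measurements are bounded by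
    \<open>G\<close>.\<close>
  have \<phi>_norm: "norm (\<phi> v k) \<le> real p / \<delta> * (2 * G)" if v: "v \<in> space ?M" and k: "0 < k" for v k
  proof -
    obtain j where j: "k = Suc j" using k by (cases k) auto
    have "\<bar>fe k (w v k + \<delta> *\<^sub>R v k) - pv v k\<bar> \<le> 2 * G"
      using bnd[OF v, of k] bnd[OF v, of j] by (simp add: pv_def j)
    then show ?thesis using \<delta> v_Rn[OF v] by (simp add: \<phi>_def abs_mult divide_right_mono mult_left_mono)
  qed
  have \<phi>_inner: "\<bar>\<phi> v k \<bullet> (w v k - us k)\<bar> \<le> real p / \<delta> * (2 * G) * D" if v: "v \<in> space ?M" and k: "0 < k" for v k
  proof -
    have "norm (\<phi> v k) * norm (w v k - us k) \<le> real p / \<delta> * (2 * G) * D"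
      using \<phi>_norm[OF v k] U(5)[OF wU[OF v] us(1)]
      by (intro mult_mono) (auto intro: order_trans[OF norm_ge_zero])
    then show ?thesis using Cauchy_Schwarz_ineq2 by (rule order_trans[rotated])
  qed
  have fw_meas: "(\<lambda>v. f k (w v k)) \<in> borel_measurable ?M" for k
  proof -
    have "(\<lambda>v. fe k (w v k)) \<in> borel_measurable ?M" by measurable
    then show ?thesis
      using measurable_cong[of ?M "\<lambda>v. f k (w v k)" "\<lambda>v. fe k (w v k)"] fe wR by simp
  qed
  have int_fw: "integrable ?M (\<lambda>v. f k (w v k))" for k
    using fw wU fw_meas by (intro integrable_const_bound[of _ G]) auto
  have int_\<phi>: "integrable ?M (\<lambda>v. \<phi> v k \<bullet> (w v k - us k))" if "0 < k" for k
    using \<phi>_inner that by (intro integrable_const_bound[of _ "real p / \<delta> * (2 * G) * D"]) auto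
  have gain: "(\<integral>v. f k (w v k) \<partial>?M) - f k (us k) \<le> (\<integral>v. \<phi> v k \<bullet> (w v k - us k) \<partial>?M) + Lsup * \<delta>\<^sup>2"
    if k: "0 < k" for k
  proof -
    have usR: "us k \<in> Rn p" using us(1) U(1) by auto
    have "(\<integral>v. f k (w v k) - (f k (us k) + Lsup * \<delta>\<^sup>2) \<partial>Pi\<^sub>M UNIV (\<lambda>_ :: nat. uniform_sphere p))
        \<le> (\<integral>v. \<phi> v k \<bullet> (w v k - us k) \<partial>Pi\<^sub>M UNIV (\<lambda>_ :: nat. uniform_sphere p))"
    proof (rule integral_resample_mono)
      show "prob_space (uniform_sphere p)" by (rule prob_space_uniform_sphere[OF p])
      show "integrable (Pi\<^sub>M UNIV (\<lambda>_ :: nat. uniform_sphere p)) (\<lambda>v. f k (w v k) - (f k (us k) + Lsup * \<delta>\<^sup>2))"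
        using int_fw by (simp add: exploration_def[symmetric])
      show "integrable (Pi\<^sub>M UNIV (\<lambda>_ :: nat. uniform_sphere p)) (\<lambda>v. \<phi> v k \<bullet> (w v k - us k))"
        using int_\<phi>[OF k] by (simp add: exploration_def[symmetric])
      fix v assume "v \<in> space (Pi\<^sub>M UNIV (\<lambda>_ :: nat. uniform_sphere p))"
      then have v: "v \<in> space ?M" by (simp add: exploration_def)
      interpret V: prob_space "uniform_sphere p" by (rule prob_space_uniform_sphere[OF p])
      have same: "w (v(k := s)) k = w v k \<and> pv (v(k := s)) k = pv v k" if "s \<in> unit_sphere p" for s
        using v that by (intro causal) (auto simp: sp)
      have "(\<integral>s. f k (w (v(k := s)) k) - (f k (us k) + Lsup * \<delta>\<^sup>2) \<partial>uniform_sphere p)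
          = (\<integral>s. f k (w v k) - (f k (us k) + Lsup * \<delta>\<^sup>2) \<partial>uniform_sphere p)"
        by (rule Bochner_Integration.integral_cong) (use same in auto)
      also have "\<dots> = fe k (w v k) - fe k (us k) - Lsup * \<delta>\<^sup>2"
        using V.prob_space fe wR[OF v] usR by simp
      also have "\<dots> \<le> real p / \<delta> * (\<integral>s. (fe k (w v k + \<delta> *\<^sub>R s) - pv v k) * (s \<bullet> (w v k - us k)) \<partial>uniform_sphere p)"
      proof (rule one_point_gradient_estimate[OF p fe_cvx fe_lip wR[OF v] usR \<delta>(1)])
        show "0 \<le> Lsup" using setting_smooth[OF S] by (rule lipschitz_on_nonneg)
        fix z assume z: "z \<in> Rn p"
        note diff = setting_differentiable[OF S, of k]
        show "fe k (w v k) + grad p (f k) (w v k) \<bullet> (z - w v k) \<le> fe k z"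
          using convex_grad_le[OF setting_convex[OF S, of k] _ wR[OF v] z] diff wR[OF v] z
          by (simp add: fe f_def differentiable_on_def)
        show "fe k z \<le> fe k (us k) + grad p (f k) (us k) \<bullet> (z - us k) + Lsup * (norm (z - us k))\<^sup>2"
          using smooth_convex_upper_bound[OF setting_convex[OF S] diff setting_smooth[OF S] usR z] usR z
          by (simp add: fe f_def)
      qed
      also have "\<dots> = (\<integral>s. real p / \<delta> * ((fe k (w v k + \<delta> *\<^sub>R s) - pv v k) * (s \<bullet> (w v k - us k))) \<partial>uniform_sphere p)"
        by simp
      also have "\<dots> = (\<integral>s. \<phi> (v(k := s)) k \<bullet> (w (v(k := s)) k - us k) \<partial>uniform_sphere p)"
        by (rule Bochner_Integration.integral_cong) (use same in \<open>auto simp: \<phi>_def\<close>)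
      finally show "(\<integral>s. f k (w (v(k := s)) k) - (f k (us k) + Lsup * \<delta>\<^sup>2) \<partial>uniform_sphere p)
          \<le> (\<integral>s. \<phi> (v(k := s)) k \<bullet> (w (v(k := s)) k - us k) \<partial>uniform_sphere p)" .
    qed
    then show ?thesis using int_fw prob_space by (simp add: exploration_def[symmetric])
  qed
  let ?B = "(D\<^sup>2 + 2 * D * path_length us T) / (2 * \<eta>) + \<eta> / 2 * (real T * (real p / \<delta> * (2 * G))\<^sup>2)"
  \<comment> \<open>The descent inequality holds on every sample path with a deterministic
    right-hand side, so the expectation is taken only afterwards.\<close>
  have path: "(\<Sum>k=1..T. \<phi> v k \<bullet> (w v k - us k)) \<le> ?B" if v: "v \<in> space ?M" for v
  proof -
    have "(\<Sum>k=1..T. \<phi> v k \<bullet> (w v k - us k))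
        \<le> (D\<^sup>2 + 2 * D * path_length us T) / (2 * \<eta>) + \<eta> / 2 * (\<Sum>k=1..T. (norm (\<phi> v k))\<^sup>2)"
      using U us w_Suc[OF v] wU[OF v] \<eta> T by (intro projected_gradient_regret[of U]) auto
    moreover have "(\<Sum>k=1..T. (norm (\<phi> v k))\<^sup>2) \<le> (\<Sum>k=1..T. (real p / \<delta> * (2 * G))\<^sup>2)"
      using \<phi>_norm[OF v] by (intro sum_mono power_mono) auto
    then have "\<eta> / 2 * (\<Sum>k=1..T. (norm (\<phi> v k))\<^sup>2) \<le> \<eta> / 2 * (real T * (real p / \<delta> * (2 * G))\<^sup>2)"
      using \<eta> by (intro mult_left_mono) simp_all
    ultimately show ?thesis by linarith
  qed
  have "dynamic_regret f (\<lambda>k. \<integral>v. f k (w v k) \<partial>?M) us T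
      \<le> (\<Sum>k=1..T. (\<integral>v. \<phi> v k \<bullet> (w v k - us k) \<partial>?M) + Lsup * \<delta>\<^sup>2)"
    unfolding dynamic_regret_def using gain by (intro sum_mono) auto
  also have "\<dots> = (\<integral>v. (\<Sum>k=1..T. \<phi> v k \<bullet> (w v k - us k)) \<partial>?M) + real T * (Lsup * \<delta>\<^sup>2)"
    using int_\<phi> by (subst Bochner_Integration.integral_sum) (auto simp: sum.distrib)
  also have "\<dots> \<le> ?B + real T * (Lsup * \<delta>\<^sup>2)"
  proof -
    have "(\<integral>v. (\<Sum>k=1..T. \<phi> v k \<bullet> (w v k - us k)) \<partial>?M) \<le> ?B"
      using int_\<phi> path by (intro integral_le_const integrable_sum AE_I2) auto
    then show ?thesis by simp
  qed
  finally show "dynamic_regret (reduced \<Phi> h d) (\<lambda>k. \<integral>v. reduced \<Phi> h d k (w v k) \<partial>exploration p) us T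
      \<le> ?B + real T * (Lsup * \<delta>\<^sup>2)"
    by (simp add: f_def)
  have "(\<integral>v. f k (w v k) \<partial>?M) - f k (us k) \<le> 2 * G" for k
  proof -
    have "(\<integral>v. f k (w v k) \<partial>?M) \<le> G"
      using fw wU by (intro integral_le_const int_fw AE_I2) (auto simp: abs_le_iff)
    then show ?thesis using fw[OF us(1), of k k] by linarith
  qed
  then have "dynamic_regret f (\<lambda>k. \<integral>v. f k (w v k) \<partial>?M) us T \<le> (\<Sum>k=1..T. 2 * G)"
    unfolding dynamic_regret_def by (intro sum_mono)
  then show "dynamic_regret (reduced \<Phi> h d) (\<lambda>k. \<integral>v. reduced \<Phi> h d k (w v k) \<partial>exploration p) us T \<le> 2 * G * real T"
    by (simp add: f_def mult.commute)
qed

lemma model_free_regret_bound_holds: "model_free_regret_bound G \<tau> D Rsup Lsup Msup M\<Phi>sup"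
  unfolding model_free_regret_bound_def
\<comment> \<open>\<open>D\<^sup>2 / 2\<close> and \<open>D\<close> come from the comparator terms,
  \<open>2 * G\<^sup>2\<close> from the squared estimates, \<open>Lsup\<close> from the bias, and
  \<open>2 * G / \<tau>\<^sup>2\<close> from the case where \<open>\<delta>\<close> is
  capped.\<close>
proof (intro exI[of _ "D\<^sup>2 / 2 + D + 2 * G\<^sup>2 + Lsup + 2 * G / \<tau>\<^sup>2"] exI[of _ 0] allI impI)
  fix p q r :: nat and U \<Phi> h d us and T :: nat and w0 \<phi>0 w u y
  \<comment> \<open>In terms of \<open>a\<close> and \<open>b\<close> all fractional powers become
    integral: \<open>p = a ^ 3\<close>, \<open>T = b ^ 6\<close>, the uncapped
    \<open>\<delta>\<close> is \<open>a / b\<close>, and the target rate is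
    \<open>a ^ 2 * b ^ 4\<close>.\<close>
  define a where "a = real p powr (1/3)"
  define b where "b = real T powr (1/6)"
  assume S: "setting p q r U \<Phi> h d us G \<tau> D Rsup Lsup Msup M\<Phi>sup" and T: "0 < T" and w0: "w0 \<in> U"
    and loop0: "\<forall>v \<in> space (exploration p). model_free_loop p U \<Phi> h d
        (1 / (real p powr (2/3) * real T powr (2/3))) (min (real p powr (1/3) / real T powr (1/6)) \<tau>)
        w0 \<phi>0 v (w v) (u v) (y v)"
  have p: "0 < p" using S by (rule setting_dims)
  have ab: "0 < a" "0 < b" using p T by (auto simp: a_def b_def)
  have pow: "real p powr (2/3) = a ^ 2" "real T powr (2/3) = b ^ 4" "real p = a ^ 3" "real T = b ^ 6"
    using p T unfolding a_def b_def by (simp_all add: powr_power)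
  let ?CT = "path_length us T" and ?s = "a ^ 2 * b ^ 4" and ?\<delta> = "min (a / b) \<tau>"
  let ?reg = "dynamic_regret (reduced \<Phi> h d) (\<lambda>k. \<integral>v. reduced \<Phi> h d k (w v k) \<partial>exploration p) us T"
  have loop: "\<forall>v \<in> space (exploration p). model_free_loop p U \<Phi> h d (1 / ?s) ?\<delta> w0 \<phi>0 v (w v) (u v) (y v)"
    using loop0 by (simp only: pow(1,2) a_def[symmetric] b_def[symmetric])
  have G: "0 \<le> G" "0 < \<tau>" using setting_G[OF S] by auto
  have D: "0 < D" using setting_U[OF S] by auto
  have L: "0 \<le> Lsup" using setting_smooth[OF S] by (rule lipschitz_on_nonneg)
  have CT: "0 \<le> ?CT" by (rule path_length_nonneg)
  have s: "0 < ?s" using ab by simp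
  have \<delta>: "0 < ?\<delta>" "?\<delta> \<le> \<tau>" using ab G by auto
  have \<eta>: "0 < 1 / ?s" using s by simp
  note reg = model_free_regret[OF S w0 \<eta> \<delta> T loop]
  have "?reg \<le> (D\<^sup>2 / 2 + D + 2 * G\<^sup>2 + Lsup + 2 * G / \<tau>\<^sup>2) * (?s * (?CT + 1))"
  proof (cases "a / b \<le> \<tau>")
    case True
    then have \<delta>_eq: "?\<delta> = a / b" by simp
    have e1: "(D\<^sup>2 + 2 * D * ?CT) / (2 * (1 / ?s)) = D\<^sup>2 / 2 * ?s + D * (?s * ?CT)"
      using ab by (simp add: field_simps)
    have e2: "1 / ?s / 2 * (real T * (real p / (a / b) * (2 * G))\<^sup>2) = 2 * G\<^sup>2 * ?s"
      unfolding pow using ab by (simp add: field_simps power_mult_distrib eval_nat_numeral)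
    have e3: "real T * (Lsup * (a / b)\<^sup>2) = Lsup * ?s"
      unfolding pow using ab by (simp add: field_simps eval_nat_numeral)
    have "?reg \<le> D\<^sup>2 / 2 * ?s + D * (?s * ?CT) + 2 * G\<^sup>2 * ?s + Lsup * ?s"
      using reg(1) unfolding \<delta>_eq e1 e2 e3 .
    moreover define x where "x = ?s * (?CT + 1)"
    have x: "?s \<le> x" "?s * ?CT \<le> x" "0 \<le> x" using s CT by (auto simp: x_def algebra_simps)
    have "D\<^sup>2 / 2 * ?s \<le> D\<^sup>2 / 2 * x" "D * (?s * ?CT) \<le> D * x" "2 * G\<^sup>2 * ?s \<le> 2 * G\<^sup>2 * x" "Lsup * ?s \<le> Lsup * x"
        "0 \<le> 2 * G / \<tau>\<^sup>2 * x"
      using x D G L by (auto intro!: mult_left_mono)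
    ultimately show ?thesis unfolding x_def[symmetric] by (simp only: distrib_right)
  next
    case False
    then have "(\<tau> * b)\<^sup>2 \<le> a\<^sup>2" using ab G by (intro power_mono) (auto simp: field_simps)
    then have "(\<tau> * b)\<^sup>2 * b ^ 4 \<le> a\<^sup>2 * b ^ 4" using ab by (intro mult_right_mono) auto
    then have "\<tau>\<^sup>2 * real T \<le> ?s" unfolding pow by (simp add: power_mult_distrib eval_nat_numeral ac_simps)
    then have "real T \<le> ?s / \<tau>\<^sup>2" using G by (simp add: field_simps)
    then have "2 * G * real T \<le> 2 * G * (?s / \<tau>\<^sup>2)" using G by (intro mult_left_mono) auto
    also have "\<dots> = 2 * G / \<tau>\<^sup>2 * ?s" by simp
    also have "\<dots> \<le> (D\<^sup>2 / 2 + D + 2 * G\<^sup>2 + Lsup + 2 * G / \<tau>\<^sup>2) * (?s * (?CT + 1))"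
      by (rule mult_mono) (use D G L s CT mult_left_mono[of 1 "?CT + 1" ?s] in simp_all)
    finally show ?thesis using reg(2) by linarith
  qed
  then show "?reg \<le> (D\<^sup>2 / 2 + D + 2 * G\<^sup>2 + Lsup + 2 * G / \<tau>\<^sup>2)
      * (real p powr (2/3) * real T powr (2/3) * (?CT + 1))"
    unfolding pow(1,2) .
qed

theorem theorem8:
  fixes G \<tau> D Rsup Lsup Msup M\<Phi>sup :: real
  shows
    "(\<forall>\<theta> \<epsilon>'. \<theta> \<ge> 1/3 \<longrightarrow> \<epsilon>' > 0 \<longrightarrow>
        model_based_regret_bound (\<lambda>k. \<epsilon>' / (real k + 1) powr \<theta>)
          (\<lambda>T CT. sqrt (real T) * CT + real T powr (max (1/2) (1 - \<theta>)))
          G \<tau> D Rsup Lsup Msup M\<Phi>sup)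
   \<and> (\<forall>\<epsilon>. \<epsilon> > 0 \<longrightarrow>
        model_based_regret_bound (\<lambda>k. \<epsilon>)
          (\<lambda>T CT. sqrt (real T) * (CT + 1) + real T)
          G \<tau> D Rsup Lsup Msup M\<Phi>sup)
   \<and> (\<forall>\<theta> \<epsilon>'. 0 < \<theta> \<longrightarrow> \<theta> < 1/3 \<longrightarrow> \<epsilon>' > 0 \<longrightarrow>
        model_based_regret_bound (\<lambda>k. \<epsilon>' / (real k + 1) powr \<theta>)
          (\<lambda>T CT. sqrt (real T) * (CT + 1) + real T powr (1 - \<theta>))
          G \<tau> D Rsup Lsup Msup M\<Phi>sup)
   \<and> model_free_regret_bound G \<tau> D Rsup Lsup Msup M\<Phi>sup"
proof (intro conjI allI impI)
  fix \<theta> \<epsilon>' :: real assume "\<theta> \<ge> 1/3" "\<epsilon>' > 0"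
  moreover have "1 - min \<theta> (1/2) = max (1/2) (1 - \<theta>)" by (simp add: min_def max_def)
  ultimately show "model_based_regret_bound (\<lambda>k. \<epsilon>' / (real k + 1) powr \<theta>)
      (\<lambda>T CT. sqrt (real T) * CT + real T powr (max (1/2) (1 - \<theta>))) G \<tau> D Rsup Lsup Msup M\<Phi>sup"
    by (intro model_based_regret_bound_decaying) auto
next
  fix \<theta> \<epsilon>' :: real assume "0 < \<theta>" "\<theta> < 1/3" "\<epsilon>' > 0"
  then show "model_based_regret_bound (\<lambda>k. \<epsilon>' / (real k + 1) powr \<theta>)
      (\<lambda>T CT. sqrt (real T) * (CT + 1) + real T powr (1 - \<theta>)) G \<tau> D Rsup Lsup Msup M\<Phi>sup"
    by (intro model_based_regret_bound_decaying) (auto simp: min_def distrib_left)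
qed (auto intro: model_based_regret_bound_constant model_free_regret_bound_holds)

end
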